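(* Let $(V,\sigma)$ be a braided vector space over $\mathbb{C}$ whose braiding $\sigma$ is of Hecke type with parameter $\nu\in\mathbb{C}^\ast$, $\nu$ not a root of unity, and suppose that for some $M$ one has $\dim S_\sigma^M(V)=1$ and $\dim S_\sigma^p(V)=0$ for all $p>M$. Then the q-trace $\mathrm{Tr}_q:\bigoplus_{p=0}^{M}\mathrm{End}\,S_\sigma^p(V)\to\mathbb{C}$ is an algebra morphism with respect to the third product $\times$. Precisely, for all $\mathbf{A},\mathbf{B}\in\bigoplus_{p=0}^{M}\mathrm{End}\,S_\sigma^p(V)$: 1. $\mathrm{Tr}_q(\mathbf{A}+\mathbf{B})=\mathrm{Tr}_q\mathbf{A}+\mathrm{Tr}_q\mathbf{B}$; 2. $\mathrm{Tr}_q(\mathbf{A}\times\mathbf{B})=(\mathrm{Tr}_q\mathbf{A})(\mathrm{Tr}_q\mathbf{B})$; 3. $\mathrm{Tr}_q(\mathbf{A}\times\mathbf{B})=\mathrm{Tr}_q(\mathbf{B}\times\mathbf{A})$.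
   Context: A braiding on a complex vector space $V$ is an invertible $\sigma\in\mathrm{End}(V\otimes V)$ with $(\sigma\otimes \mathrm{id})(\mathrm{id}\otimes\sigma)(\sigma\otimes \mathrm{id})=(\mathrm{id}\otimes\sigma)(\sigma\otimes \mathrm{id})(\mathrm{id}\otimes\sigma)$; $(V,\sigma)$ is then a braided vector space. $\sigma$ is of Hecke type with parameter $\nu\in\mathbb{C}^\ast$ if $(\sigma+\mathrm{id})(\sigma-\nu\,\mathrm{id})=0$. On $V^{\otimes p}$ let $\sigma_i=\mathrm{id}^{\otimes(i-1)}\otimes\sigma\otimes\mathrm{id}^{\otimes(p-i-1)}$; for $w\in\mathfrak{S}_p$ with reduced expression $w=s_{i_1}\cdots s_{i_l}$ ($s_i=(i,i+1)$) let $T_w=\sigma_{i_1}\cdots\sigma_{i_l}$. Put $A^{(p)}=\sum_{w\in\mathfrak{S}_p}T_w$ and $S_\sigma^p(V)=\mathrm{Im}\,A^{(p)}\subset V^{\otimes p}$ (so $S^0_\sigma(V)=\mathbb{C}$, $S^1_\sigma(V)=V$). Let $\mathfrak{S}_{i,j}\subset\mathfrak{S}_{i+j}$ be the set of $w$ with $w(1)<\cdots<w(i)$ and $w(i+1)<\cdots<w(i+j)$. The quantum shuffle product is $sh=\sum_{w\in\mathfrak{S}_{i,j}}T_w: V^{\otimes i}\otimes V^{\otimes j}\to V^{\otimes(i+j)}$; it maps $S_\sigma^i(V)\otimes S_\sigma^j(V)$ to $S_\sigma^{i+j}(V)$. The deconcatenation $\delta_{i,j}:V^{\otimes(i+j)}\to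 V^{\otimes i}\otimes V^{\otimes j}$, $v_1\otimes\cdots\otimes v_{i+j}\mapsto(v_1\otimes\cdots\otimes v_i)\otimes(v_{i+1}\otimes\cdots\otimes v_{i+j})$, maps $S_\sigma^{i+j}(V)$ to $S_\sigma^i(V)\otimes S_\sigma^j(V)$. Elements of $\bigoplus_{p=0}^M\mathrm{End}\,S_\sigma^p(V)$ are written $\mathbf{A}=(A_0,\ldots,A_M)$. Composition product: $(\mathbf{A}\circ\mathbf{B})_p=A_p\circ B_p$. Convolution product: $(\mathbf{A}\ast\mathbf{B})_p=\sum_{l=0}^pA_l\ast B_{p-l}$, where $A_i\ast B_j=sh\circ(A_i\otimes B_j)\circ\delta_{i,j}\in\mathrm{End}\,S_\sigma^{i+j}(V)$. Let $\mathrm{I}_p$ be the identity of $S_\sigma^p(V)$; $\mathrm{I}_0=(\mathrm{I}_0,0,\ldots,0)$ is the unit for $\ast$. Put $(n)_\nu=(1-\nu^n)/(1-\nu)$, $(n)_\nu!=(1)_\nu\cdots(n)_\nu$, $(0)_\nu!=1$. Let $e_\nu^{\ast\mathrm{I}_1}=(\mathrm{I}_0,\mathrm{I}_1,\ldots,\mathrm{I}_M)$ (its $p$-th component equals $\frac1{(p)_\nu!}\mathrm{I}_1^{\ast p}$); it has a two-sided inverse for $\ast$, $(e_\nu^{\ast\mathrm{I}_1})^{-1}$, with $p$-th component $\frac{(-1)^p\nu^{p(p-1)/2}}{(p)_\nu!}\mathrm{I}_1^{\ast p}$. Define $\alpha(\mathbf{A})=\mathbf{A}\ast e_\nu^{\ast\mathrm{I}_1}$,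 a linear bijection with inverse $\alpha^{-1}(\mathbf{A})=\mathbf{A}\ast(e_\nu^{\ast\mathrm{I}_1})^{-1}$. The third product is $\mathbf{A}\times\mathbf{B}=\alpha^{-1}\big((\alpha\mathbf{A})\circ(\alpha\mathbf{B})\big)$. The q-trace $\mathrm{Tr}_q\mathbf{A}\in\mathbb{C}$ is the unique scalar with $(\alpha\mathbf{A})_M=(\mathrm{Tr}_q\mathbf{A})\,\mathrm{I}_M$ in $\mathrm{End}\,S_\sigma^M(V)$. *)

theory Defs
  imports Complex_Main "HOL-Library.Poly_Mapping" "HOL-Combinatorics.Permutations"
begin

section \<open>Complex vector spaces\<close>

class complex_vector = ab_group_add +
  fixes scaleC :: "complex \<Rightarrow> 'a \<Rightarrow> 'a"  (infixr "*\<^sub>C" 75)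
  assumes scaleC_add_right: "c *\<^sub>C (x + y) = c *\<^sub>C x + c *\<^sub>C y"
    and scaleC_add_left: "(c + d) *\<^sub>C x = c *\<^sub>C x + d *\<^sub>C x"
    and scaleC_scaleC: "c *\<^sub>C d *\<^sub>C x = (c * d) *\<^sub>C x"
    and scaleC_one: "1 *\<^sub>C x = x"

global_interpretation cvec: vector_space "scaleC :: complex \<Rightarrow> 'a \<Rightarrow> 'a::complex_vector"
  by unfold_locales
    (simp_all add: scaleC_add_right scaleC_add_left scaleC_scaleC scaleC_one)

abbreviation clinear :: "('a::complex_vector \<Rightarrow> 'b::complex_vector) \<Rightarrow> bool"
  where "clinear \<equiv> Vector_Spaces.linear scaleC scaleC"

text \<open>The library's \<open>dim\<close> is \<open>0\<close> on infinite-dimensional spaces, so that \<open>dim U = 0\<close> would not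
  express that \<open>U\<close> is the zero space.  Hence the dimension is stated by exhibiting a finite basis.\<close>

definition has_dim :: "'a::complex_vector set \<Rightarrow> nat \<Rightarrow> bool"
  where "has_dim U n \<longleftrightarrow>
    (\<exists>B. finite B \<and> card B = n \<and> \<not> cvec.dependent B \<and> cvec.span B = U)"

definition clinear_on :: "'a::complex_vector set \<Rightarrow> ('a \<Rightarrow> 'b::complex_vector) \<Rightarrow> bool"
  where "clinear_on U f \<longleftrightarrow>
    (\<forall>x\<in>U. \<forall>y\<in>U. f (x + y) = f x + f y) \<and> (\<forall>c. \<forall>x\<in>U. f (c *\<^sub>C x) = c *\<^sub>C f x)"

text \<open>Linear maps between subspaces are represented by functions on the ambient space that vanish
  outside the domain, so that equality of functions is equality of maps.  They are in general not
  linear on the ambient space.\<close>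

definition Hom :: "'a::complex_vector set \<Rightarrow> 'b::complex_vector set \<Rightarrow> ('a \<Rightarrow> 'b) set"
  where "Hom U W = {f. clinear_on U f \<and> f ` U \<subseteq> W \<and> (\<forall>x. x \<notin> U \<longrightarrow> f x = 0)}"

abbreviation End :: "'a::complex_vector set \<Rightarrow> ('a \<Rightarrow> 'a) set"
  where "End U \<equiv> Hom U U"

definition restrict0 :: "'a set \<Rightarrow> ('a \<Rightarrow> 'b::zero) \<Rightarrow> 'a \<Rightarrow> 'b"
  where "restrict0 U f = (\<lambda>x. if x \<in> U then f x else 0)"

abbreviation Id_on_space :: "'a::complex_vector set \<Rightarrow> 'a \<Rightarrow> 'a"
  where "Id_on_space U \<equiv> restrict0 U (\<lambda>x. x)"

lemma equivp_diff_span: "equivp (\<lambda>f g. f - g \<in> cvec.span R)"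
proof (rule equivpI)
  show "reflp (\<lambda>f g. f - g \<in> cvec.span R)"
    by (simp add: reflp_def cvec.span_zero)
  show "symp (\<lambda>f g. f - g \<in> cvec.span R)"
    by (rule sympI) (drule cvec.span_neg, simp)
  show "transp (\<lambda>f g. f - g \<in> cvec.span R)"
  proof (rule transpI)
    fix f g h assume "f - g \<in> cvec.span R" "g - h \<in> cvec.span R"
    then have "(f - g) + (g - h) \<in> cvec.span R" by (rule cvec.span_add)
    then show "f - h \<in> cvec.span R" by simp
  qed
qed

subsection \<open>Finite formal linear combinations\<close>

instantiation poly_mapping :: (type, complex_vector) complex_vector
begin

definition scaleC_poly_mapping :: "complex \<Rightarrow> ('a \<Rightarrow>\<^sub>0 'b) \<Rightarrow> 'a \<Rightarrow>\<^sub>0 'b"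
  where "scaleC_poly_mapping c = Poly_Mapping.map (scaleC c)"

lemma lookup_scaleC: "Poly_Mapping.lookup (c *\<^sub>C f) k = c *\<^sub>C Poly_Mapping.lookup f k"
  by (simp add: scaleC_poly_mapping_def Poly_Mapping.map.rep_eq when_def)

instance
  by standard (rule poly_mapping_eqI; simp add: lookup_scaleC lookup_add
      scaleC_add_right scaleC_add_left scaleC_scaleC scaleC_one)+

end

instantiation complex :: complex_vector
begin

definition scaleC_complex :: "complex \<Rightarrow> complex \<Rightarrow> complex"
  where "scaleC_complex = (*)"

instance
  by standard (simp_all add: scaleC_complex_def algebra_simps)

end

abbreviation gen :: "'x \<Rightarrow> 'x \<Rightarrow>\<^sub>0 complex"
  where "gen x \<equiv> Poly_Mapping.single x 1"

definition free_ext :: "('x \<Rightarrow> 'c::complex_vector) \<Rightarrow> ('x \<Rightarrow>\<^sub>0 complex) \<Rightarrow> 'c"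
  where "free_ext g f = (\<Sum>k\<in>Poly_Mapping.keys f. Poly_Mapping.lookup f k *\<^sub>C g k)"

lemma clinearI:
  assumes "\<And>x y. f (x + y) = f x + f y" and "\<And>c x. f (c *\<^sub>C x) = c *\<^sub>C f x"
  shows "clinear f"
  by (simp add: Vector_Spaces.linear_iff cvec.vector_space_axioms assms)

lemma free_ext_superset:
  assumes "finite K" "Poly_Mapping.keys f \<subseteq> K"
  shows "free_ext g f = (\<Sum>k\<in>K. Poly_Mapping.lookup f k *\<^sub>C g k)"
  unfolding free_ext_def using assms
  by (intro sum.mono_neutral_left) (auto simp: in_keys_iff)

lemma clinear_free_ext: "clinear (free_ext g)"
proof (rule clinearI)
  fix f f' :: "'a \<Rightarrow>\<^sub>0 complex" and c :: complex
  let ?K = "Poly_Mapping.keys f \<union> Poly_Mapping.keys f'"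
  have "Poly_Mapping.keys (f + f') \<subseteq> ?K"
    by (rule Poly_Mapping.keys_add)
  then show "free_ext g (f + f') = free_ext g f + free_ext g f'"
    by (simp add: free_ext_superset[of ?K] lookup_add cvec.scale_left_distrib sum.distrib)
  have "Poly_Mapping.keys (c *\<^sub>C f) \<subseteq> Poly_Mapping.keys f"
    by (auto simp: in_keys_iff lookup_scaleC scaleC_complex_def)
  then show "free_ext g (c *\<^sub>C f) = c *\<^sub>C free_ext g f"
    by (simp add: free_ext_superset[of "Poly_Mapping.keys f"] lookup_scaleC
        cvec.scale_sum_right scaleC_complex_def)
qed

lemma free_ext_gen [simp]: "free_ext g (gen x) = g x"
  by (simp add: free_ext_def)

lemma free_span:
  fixes f :: "'x \<Rightarrow>\<^sub>0 complex"
  shows "f \<in> cvec.span (range gen)"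
proof -
  have *: "Poly_Mapping.single k v = v *\<^sub>C gen k" for k :: 'x and v
    by (rule poly_mapping_eqI) (simp add: lookup_scaleC scaleC_complex_def lookup_single when_def)
  have "f = (\<Sum>k\<in>Poly_Mapping.keys f. Poly_Mapping.lookup f k *\<^sub>C gen k)"
    unfolding *[symmetric]
    by (rule poly_mapping_eqI)
      (simp add: lookup_sum lookup_single when_def in_keys_iff)
  also have "\<dots> \<in> cvec.span (range gen)"
    by (intro cvec.span_sum cvec.span_scale cvec.span_base) auto
  finally show ?thesis .
qed

lemma clinear_kills_span:
  assumes "clinear h" "\<And>r. r \<in> R \<Longrightarrow> h r = 0" "f - f' \<in> cvec.span R"
  shows "h f = h f'"
proof -
  interpret Vector_Spaces.linear scaleC scaleC h by fact
  have "h (f - f') = 0"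
    using eq_0_on_span[OF assms(2) assms(3)] by simp
  then show ?thesis by (simp add: diff)
qed


section \<open>Tensor products\<close>

subsection \<open>The tensor product of two vector spaces\<close>

text \<open>The free vector space on the pairs modulo the bilinearity relations.\<close>

definition tensor_relations :: "('a::complex_vector \<times> 'b::complex_vector \<Rightarrow>\<^sub>0 complex) set"
  where "tensor_relations =
      {gen (x + x', y) - gen (x, y) - gen (x', y) | x x' y. True}
    \<union> {gen (x, y + y') - gen (x, y) - gen (x, y') | x y y'. True}
    \<union> {gen (c *\<^sub>C x, y) - c *\<^sub>C gen (x, y) | c x y. True}
    \<union> {gen (x, c *\<^sub>C y) - c *\<^sub>C gen (x, y) | c x y. True}"

quotient_type (overloaded) ('a, 'b) tensor =
  "('a::complex_vector \<times> 'b::complex_vector) \<Rightarrow>\<^sub>0 complex" /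
  "\<lambda>f g. f - g \<in> cvec.span tensor_relations"
  by (rule equivp_diff_span)

instantiation tensor :: (complex_vector, complex_vector) complex_vector
begin

lift_definition zero_tensor :: "('a, 'b) tensor" is 0 .

lift_definition plus_tensor :: "('a, 'b) tensor \<Rightarrow> ('a, 'b) tensor \<Rightarrow> ('a, 'b) tensor" is "(+)"
  using cvec.span_add by (fastforce simp: algebra_simps)

lift_definition uminus_tensor :: "('a, 'b) tensor \<Rightarrow> ('a, 'b) tensor" is uminus
  using cvec.span_neg by (fastforce simp: algebra_simps)

lift_definition minus_tensor :: "('a, 'b) tensor \<Rightarrow> ('a, 'b) tensor \<Rightarrow> ('a, 'b) tensor" is "(-)"
  using cvec.span_diff by (fastforce simp: algebra_simps)

lift_definition scaleC_tensor :: "complex \<Rightarrow> ('a, 'b) tensor \<Rightarrow> ('a, 'b) tensor" is scaleC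
  using cvec.span_scale by (fastforce simp: cvec.scale_right_diff_distrib[symmetric])

instance
  by standard (transfer; simp add: cvec.span_zero algebra_simps)+

end

lift_definition tens :: "'a::complex_vector \<Rightarrow> 'b::complex_vector \<Rightarrow> ('a, 'b) tensor"
  (infixr "\<otimes>" 70) is "\<lambda>x y. gen (x, y)" .

definition tensor_lift ::
  "('a::complex_vector \<Rightarrow> 'b::complex_vector \<Rightarrow> 'c::complex_vector) \<Rightarrow> ('a, 'b) tensor \<Rightarrow> 'c"
  where "tensor_lift g = (THE h. clinear h \<and> (\<forall>x y. h (x \<otimes> y) = g x y))"

lemma tensor_lift:
  fixes g :: "'a::complex_vector \<Rightarrow> 'b::complex_vector \<Rightarrow> 'c::complex_vector"
  assumes "\<And>y. clinear (\<lambda>x. g x y)" and "\<And>x. clinear (g x)"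
  shows "clinear (tensor_lift g)" and "tensor_lift g (x \<otimes> y) = g x y"
proof -
  have lin: "g (x + x') y = g x y + g x' y" "g (c *\<^sub>C x) y = c *\<^sub>C g x y"
    "g x (y + y') = g x y + g x y'" "g x (c *\<^sub>C y) = c *\<^sub>C g x y" for x x' y y' c
    using assms(1)[of y] assms(2)[of x] by (auto simp: Vector_Spaces.linear_iff)
  define F where "F = free_ext (\<lambda>(x, y). g x y)"
  have F: "clinear F" unfolding F_def by (rule clinear_free_ext)
  interpret F: Vector_Spaces.linear scaleC scaleC F by (rule F)
  have Fgen: "F (gen (x, y)) = g x y" for x y
    by (simp add: F_def)
  have F_rel: "F r = 0" if "r \<in> tensor_relations" for r
    using that by (auto simp: tensor_relations_def F.diff F.scale Fgen lin)
  have F_cong: "F f = F f'" if "f - f' \<in> cvec.span tensor_relations" for f f'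
    by (rule clinear_kills_span[OF F F_rel that])
  define h where "h t = F (rep_tensor t)" for t
  have h_abs: "h (abs_tensor f) = F f" for f
    unfolding h_def
    by (rule F_cong) (rule rep_abs_rsp_left[OF Quotient3_tensor], simp add: cvec.span_zero)
  have "clinear h"
  proof (rule clinearI)
    fix s t :: "('a, 'b) tensor" and c
    obtain f f' where "s = abs_tensor f" "t = abs_tensor f'"
      by (metis Quotient3_abs_rep[OF Quotient3_tensor])
    then show "h (s + t) = h s + h t" "h (c *\<^sub>C s) = c *\<^sub>C h s"
      by (simp_all add: plus_tensor.abs_eq scaleC_tensor.abs_eq h_abs F.add F.scale)
  qed
  moreover have "h (x \<otimes> y) = g x y" for x y
    by (simp add: tens.abs_eq h_abs Fgen)
  moreover have "h' = h" if h': "clinear h'" "\<forall>x y. h' (x \<otimes> y) = g x y" for h'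
  proof
    fix t :: "('a, 'b) tensor"
    interpret h': Vector_Spaces.linear scaleC scaleC h' by (rule h'(1))
    interpret d: Vector_Spaces.linear scaleC scaleC
      "\<lambda>f :: 'a \<times> 'b \<Rightarrow>\<^sub>0 complex. h' (abs_tensor f)"
      by (rule clinearI)
        (simp_all add: plus_tensor.abs_eq[symmetric] scaleC_tensor.abs_eq[symmetric] h'.add h'.scale)
    interpret p: vector_space_pair
      "scaleC :: complex \<Rightarrow> ('a \<times> 'b \<Rightarrow>\<^sub>0 complex) \<Rightarrow> _" "scaleC :: complex \<Rightarrow> 'c \<Rightarrow> 'c" ..
    obtain f where f: "t = abs_tensor f"
      by (metis Quotient3_abs_rep[OF Quotient3_tensor])
    have "h' (abs_tensor f) = F f"
      by (rule p.linear_eq_on[OF d.linear_axioms F free_span])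
        (use h'(2) in \<open>auto simp: Fgen tens.abs_eq\<close>)
    then show "h' t = h t" by (simp add: f h_abs)
  qed
  ultimately have "\<exists>!h. clinear h \<and> (\<forall>x y. h (x \<otimes> y) = g x y)"
    by blast
  from theI'[OF this] show "clinear (tensor_lift g)" "tensor_lift g (x \<otimes> y) = g x y"
    unfolding tensor_lift_def by auto
qed

definition tensor_space ::
  "'a::complex_vector set \<Rightarrow> 'b::complex_vector set \<Rightarrow> ('a, 'b) tensor set"
  where "tensor_space U W = cvec.span {u \<otimes> w | u w. u \<in> U \<and> w \<in> W}"

text \<open>The map \<open>f \<otimes> g\<close> for endomorphisms \<open>f\<close> of \<open>U\<close> and \<open>g\<close> of \<open>W\<close>.\<close>

definition tensor_map :: "'a::complex_vector set \<Rightarrow> 'b::complex_vector set \<Rightarrow>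
    ('a \<Rightarrow> 'a) \<Rightarrow> ('b \<Rightarrow> 'b) \<Rightarrow> ('a, 'b) tensor \<Rightarrow> ('a, 'b) tensor"
  where "tensor_map U W f g = (THE h. h \<in> End (tensor_space U W) \<and>
    (\<forall>u\<in>U. \<forall>w\<in>W. h (u \<otimes> w) = f u \<otimes> g w))"

subsection \<open>Tensor powers\<close>

text \<open>All tensor powers of a space are collected in the tensor algebra, the free vector space on
  the words modulo the multilinearity relations.\<close>

definition tensor_algebra_relations :: "('v::complex_vector list \<Rightarrow>\<^sub>0 complex) set"
  where "tensor_algebra_relations =
      {gen (us @ [x + y] @ ws) - gen (us @ [x] @ ws) - gen (us @ [y] @ ws) | us x y ws. True}
    \<union> {gen (us @ [c *\<^sub>C x] @ ws) - c *\<^sub>C gen (us @ [x] @ ws) | c us x ws. True}"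

quotient_type (overloaded) 'v tensor_algebra =
  "'v::complex_vector list \<Rightarrow>\<^sub>0 complex" /
  "\<lambda>f g. f - g \<in> cvec.span tensor_algebra_relations"
  by (rule equivp_diff_span)

instantiation tensor_algebra :: (complex_vector) complex_vector
begin

lift_definition zero_tensor_algebra :: "'a tensor_algebra" is 0 .

lift_definition plus_tensor_algebra ::
  "'a tensor_algebra \<Rightarrow> 'a tensor_algebra \<Rightarrow> 'a tensor_algebra" is "(+)"
  using cvec.span_add by (fastforce simp: algebra_simps)

lift_definition uminus_tensor_algebra :: "'a tensor_algebra \<Rightarrow> 'a tensor_algebra" is uminus
  using cvec.span_neg by (fastforce simp: algebra_simps)

lift_definition minus_tensor_algebra ::
  "'a tensor_algebra \<Rightarrow> 'a tensor_algebra \<Rightarrow> 'a tensor_algebra" is "(-)"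
  using cvec.span_diff by (fastforce simp: algebra_simps)

lift_definition scaleC_tensor_algebra ::
  "complex \<Rightarrow> 'a tensor_algebra \<Rightarrow> 'a tensor_algebra" is scaleC
  using cvec.span_scale by (fastforce simp: cvec.scale_right_diff_distrib[symmetric])

instance
  by standard (transfer; simp add: cvec.span_zero algebra_simps)+

end

text \<open>\<open>word [v\<^sub>1, \<dots>, v\<^sub>p]\<close> is \<open>v\<^sub>1 \<otimes> \<dots> \<otimes> v\<^sub>p\<close>; the empty word spans the degree \<open>0\<close> part.\<close>

lift_definition word :: "'v::complex_vector list \<Rightarrow> 'v tensor_algebra" is gen .

definition word_lift ::
  "('v::complex_vector list \<Rightarrow> 'c::complex_vector) \<Rightarrow> 'v tensor_algebra \<Rightarrow> 'c"
  where "word_lift g = (THE h. clinear h \<and> (\<forall>vs. h (word vs) = g vs))"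

lemma word_lift:
  fixes g :: "'v::complex_vector list \<Rightarrow> 'c::complex_vector"
  assumes "\<And>us ws. clinear (\<lambda>x. g (us @ [x] @ ws))"
  shows "clinear (word_lift g)" and "word_lift g (word vs) = g vs"
proof -
  have lin: "g (us @ (x + y) # ws) = g (us @ x # ws) + g (us @ y # ws)"
    "g (us @ (c *\<^sub>C x) # ws) = c *\<^sub>C g (us @ x # ws)" for us x y ws c
    using assms[of us ws] by (auto simp: Vector_Spaces.linear_iff)
  define F where "F = free_ext g"
  have F: "clinear F" unfolding F_def by (rule clinear_free_ext)
  interpret F: Vector_Spaces.linear scaleC scaleC F by (rule F)
  have Fgen: "F (gen vs) = g vs" for vs
    by (simp add: F_def)
  have F_rel: "F r = 0" if "r \<in> tensor_algebra_relations" for r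
    using that by (auto simp: tensor_algebra_relations_def F.diff F.scale Fgen lin)
  have F_cong: "F f = F f'" if "f - f' \<in> cvec.span tensor_algebra_relations" for f f'
    by (rule clinear_kills_span[OF F F_rel that])
  define h where "h t = F (rep_tensor_algebra t)" for t
  have h_abs: "h (abs_tensor_algebra f) = F f" for f
    unfolding h_def
    by (rule F_cong) (rule rep_abs_rsp_left[OF Quotient3_tensor_algebra], simp add: cvec.span_zero)
  have "clinear h"
  proof (rule clinearI)
    fix s t :: "'v tensor_algebra" and c
    obtain f f' where "s = abs_tensor_algebra f" "t = abs_tensor_algebra f'"
      by (metis Quotient3_abs_rep[OF Quotient3_tensor_algebra])
    then show "h (s + t) = h s + h t" "h (c *\<^sub>C s) = c *\<^sub>C h s"
      by (simp_all add: plus_tensor_algebra.abs_eq scaleC_tensor_algebra.abs_eq h_abs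
          F.add F.scale)
  qed
  moreover have "h (word vs) = g vs" for vs
    by (simp add: word.abs_eq h_abs Fgen)
  moreover have "h' = h" if h': "clinear h'" "\<forall>vs. h' (word vs) = g vs" for h'
  proof
    fix t :: "'v tensor_algebra"
    interpret h': Vector_Spaces.linear scaleC scaleC h' by (rule h'(1))
    interpret d: Vector_Spaces.linear scaleC scaleC
      "\<lambda>f :: 'v list \<Rightarrow>\<^sub>0 complex. h' (abs_tensor_algebra f)"
      by (rule clinearI)
        (simp_all add: plus_tensor_algebra.abs_eq[symmetric]
          scaleC_tensor_algebra.abs_eq[symmetric] h'.add h'.scale)
    interpret p: vector_space_pair
      "scaleC :: complex \<Rightarrow> ('v list \<Rightarrow>\<^sub>0 complex) \<Rightarrow> _" "scaleC :: complex \<Rightarrow> 'c \<Rightarrow> 'c" ..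
    obtain f where f: "t = abs_tensor_algebra f"
      by (metis Quotient3_abs_rep[OF Quotient3_tensor_algebra])
    have "h' (abs_tensor_algebra f) = F f"
      by (rule p.linear_eq_on[OF d.linear_axioms F free_span])
        (use h'(2) in \<open>auto simp: Fgen word.abs_eq\<close>)
    then show "h' t = h t" by (simp add: f h_abs)
  qed
  ultimately have "\<exists>!h. clinear h \<and> (\<forall>vs. h (word vs) = g vs)"
    by blast
  from theI'[OF this] show "clinear (word_lift g)" "word_lift g (word vs) = g vs"
    unfolding word_lift_def by auto
qed

definition tpow :: "nat \<Rightarrow> 'v::complex_vector tensor_algebra set"
  where "tpow p = cvec.span {word vs | vs. length vs = p}"

text \<open>The canonical map from \<open>V\<^bsup>\<otimes>i\<^esup> \<otimes> V\<^bsup>\<otimes>j\<^esup>\<close> to \<open>V\<^bsup>\<otimes>(i+j)\<^esup>\<close>, for all \<open>i\<close> and \<open>j\<close> at once.\<close>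

definition juxtapose ::
  "('v::complex_vector tensor_algebra, 'v tensor_algebra) tensor \<Rightarrow> 'v tensor_algebra"
  where "juxtapose =
    tensor_lift (\<lambda>x y. word_lift (\<lambda>us. word_lift (\<lambda>ws. word (us @ ws)) y) x)"

definition deconc :: "nat \<Rightarrow> nat \<Rightarrow> 'v::complex_vector tensor_algebra \<Rightarrow>
    ('v tensor_algebra, 'v tensor_algebra) tensor"
  where "deconc i j = word_lift (\<lambda>vs.
    if length vs = i + j then word (take i vs) \<otimes> word (drop i vs) else 0)"


section \<open>Braidings\<close>

text \<open>\<open>braid_at \<sigma> i\<close> restricts on every \<open>V\<^bsup>\<otimes>p\<^esup>\<close> with \<open>1 \<le> i < p\<close> to
  \<open>\<sigma>\<^sub>i = id\<^bsup>\<otimes>(i-1)\<^esup> \<otimes> \<sigma> \<otimes> id\<^bsup>\<otimes>(p-i-1)\<^esup>\<close>; positions are counted from 1, lists are indexed from 0.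
  On the other tensor powers it is 0 and is never used.\<close>

definition braid_at :: "(('v::complex_vector, 'v) tensor \<Rightarrow> ('v, 'v) tensor) \<Rightarrow> nat \<Rightarrow>
    'v tensor_algebra \<Rightarrow> 'v tensor_algebra"
  where "braid_at \<sigma> i = word_lift (\<lambda>vs.
    if 1 \<le> i \<and> i < length vs
    then tensor_lift (\<lambda>x y. word (take (i - 1) vs @ [x, y] @ drop (i + 1) vs))
           (\<sigma> (vs ! (i - 1) \<otimes> vs ! i))
    else 0)"

definition braiding :: "(('v::complex_vector, 'v) tensor \<Rightarrow> ('v, 'v) tensor) \<Rightarrow> bool"
  where "braiding \<sigma> \<longleftrightarrow> clinear \<sigma> \<and> bij \<sigma> \<and>
    (\<forall>x\<in>tpow 3. braid_at \<sigma> 1 (braid_at \<sigma> 2 (braid_at \<sigma> 1 x)) =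
      braid_at \<sigma> 2 (braid_at \<sigma> 1 (braid_at \<sigma> 2 x)))"

definition hecke_type ::
  "complex \<Rightarrow> (('v::complex_vector, 'v) tensor \<Rightarrow> ('v, 'v) tensor) \<Rightarrow> bool"
  where "hecke_type \<nu> \<sigma> \<longleftrightarrow> (\<forall>x. let y = \<sigma> x - \<nu> *\<^sub>C x in \<sigma> y + y = 0)"

definition perm_of_word :: "nat list \<Rightarrow> nat \<Rightarrow> nat"
  where "perm_of_word is = foldr (\<lambda>i w. transpose i (i + 1) \<circ> w) is id"

definition reduced_word :: "nat \<Rightarrow> (nat \<Rightarrow> nat) \<Rightarrow> nat list \<Rightarrow> bool"
  where "reduced_word p w is \<longleftrightarrow> set is \<subseteq> {1..<p} \<and> perm_of_word is = w \<and>
    (\<forall>js. set js \<subseteq> {1..<p} \<and> perm_of_word js = w \<longrightarrow> length is \<le> length js)"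

text \<open>By the braid relations the choice of the reduced word does not matter.\<close>

definition T_op :: "(('v::complex_vector, 'v) tensor \<Rightarrow> ('v, 'v) tensor) \<Rightarrow> nat \<Rightarrow> (nat \<Rightarrow> nat) \<Rightarrow>
    'v tensor_algebra \<Rightarrow> 'v tensor_algebra"
  where "T_op \<sigma> p w = foldr (\<lambda>i f. braid_at \<sigma> i \<circ> f) (SOME is. reduced_word p w is) id"

definition A_op :: "(('v::complex_vector, 'v) tensor \<Rightarrow> ('v, 'v) tensor) \<Rightarrow> nat \<Rightarrow>
    'v tensor_algebra \<Rightarrow> 'v tensor_algebra"
  where "A_op \<sigma> p x = (\<Sum>w | w permutes {1..p}. T_op \<sigma> p w x)"

definition S_pow :: "(('v::complex_vector, 'v) tensor \<Rightarrow> ('v, 'v) tensor) \<Rightarrow> nat \<Rightarrow>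
    'v tensor_algebra set"
  where "S_pow \<sigma> p = A_op \<sigma> p ` tpow p"

text \<open>No inverse is taken: \<open>w\<close> itself, not \<open>inv w\<close>, is increasing on the two blocks.\<close>

definition shuffles_perm :: "nat \<Rightarrow> nat \<Rightarrow> (nat \<Rightarrow> nat) set"
  where "shuffles_perm i j = {w. w permutes {1..i + j} \<and>
    strict_mono_on {1..i} w \<and> strict_mono_on {i + 1..i + j} w}"

definition sh :: "(('v::complex_vector, 'v) tensor \<Rightarrow> ('v, 'v) tensor) \<Rightarrow> nat \<Rightarrow> nat \<Rightarrow>
    ('v tensor_algebra, 'v tensor_algebra) tensor \<Rightarrow> 'v tensor_algebra"
  where "sh \<sigma> i j x = (\<Sum>w\<in>shuffles_perm i j. T_op \<sigma> (i + j) w (juxtapose x))"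


section \<open>The three products and the q-trace\<close>

type_synonym 'v family = "nat \<Rightarrow> 'v tensor_algebra \<Rightarrow> 'v tensor_algebra"

text \<open>An element \<open>(A\<^sub>0, \<dots>, A\<^sub>M)\<close> of the direct sum is extended by \<open>A\<^sub>p = 0\<close> for \<open>p > M\<close>.\<close>

definition End_sum ::
  "(('v::complex_vector, 'v) tensor \<Rightarrow> ('v, 'v) tensor) \<Rightarrow> nat \<Rightarrow> 'v family set"
  where "End_sum \<sigma> M = {A. (\<forall>p\<le>M. A p \<in> End (S_pow \<sigma> p)) \<and> (\<forall>p>M. A p = (\<lambda>_. 0))}"

definition fam_add :: "'v::complex_vector family \<Rightarrow> 'v family \<Rightarrow> 'v family"
  where "fam_add A B = (\<lambda>p x. A p x + B p x)"

definition fam_comp :: "'v::complex_vector family \<Rightarrow> 'v family \<Rightarrow> 'v family"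
  where "fam_comp A B = (\<lambda>p. A p \<circ> B p)"

definition conv2 :: "(('v::complex_vector, 'v) tensor \<Rightarrow> ('v, 'v) tensor) \<Rightarrow> nat \<Rightarrow> nat \<Rightarrow>
    ('v tensor_algebra \<Rightarrow> 'v tensor_algebra) \<Rightarrow> ('v tensor_algebra \<Rightarrow> 'v tensor_algebra) \<Rightarrow>
    'v tensor_algebra \<Rightarrow> 'v tensor_algebra"
  where "conv2 \<sigma> i j f g = restrict0 (S_pow \<sigma> (i + j))
    (sh \<sigma> i j \<circ> tensor_map (S_pow \<sigma> i) (S_pow \<sigma> j) f g \<circ> deconc i j)"

definition fam_conv :: "(('v::complex_vector, 'v) tensor \<Rightarrow> ('v, 'v) tensor) \<Rightarrow> nat \<Rightarrow>
    'v family \<Rightarrow> 'v family \<Rightarrow> 'v family"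
  where "fam_conv \<sigma> M A B = (\<lambda>p x.
    if p \<le> M then \<Sum>l\<le>p. conv2 \<sigma> l (p - l) (A l) (B (p - l)) x else 0)"

definition q_exp ::
  "(('v::complex_vector, 'v) tensor \<Rightarrow> ('v, 'v) tensor) \<Rightarrow> nat \<Rightarrow> 'v family"
  where "q_exp \<sigma> M = (\<lambda>p. if p \<le> M then Id_on_space (S_pow \<sigma> p) else (\<lambda>_. 0))"

definition alpha :: "(('v::complex_vector, 'v) tensor \<Rightarrow> ('v, 'v) tensor) \<Rightarrow> nat \<Rightarrow>
    'v family \<Rightarrow> 'v family"
  where "alpha \<sigma> M A = fam_conv \<sigma> M A (q_exp \<sigma> M)"

text \<open>The inverse of the bijection \<open>alpha\<close> of the direct sum; it is the convolution from the right
  with the inverse of \<open>q_exp\<close> for the convolution product.\<close>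

definition alpha_inv :: "(('v::complex_vector, 'v) tensor \<Rightarrow> ('v, 'v) tensor) \<Rightarrow> nat \<Rightarrow>
    'v family \<Rightarrow> 'v family"
  where "alpha_inv \<sigma> M = inv_into (End_sum \<sigma> M) (alpha \<sigma> M)"

definition third_product :: "(('v::complex_vector, 'v) tensor \<Rightarrow> ('v, 'v) tensor) \<Rightarrow> nat \<Rightarrow>
    'v family \<Rightarrow> 'v family \<Rightarrow> 'v family"
  where "third_product \<sigma> M A B = alpha_inv \<sigma> M (fam_comp (alpha \<sigma> M A) (alpha \<sigma> M B))"

definition q_trace :: "(('v::complex_vector, 'v) tensor \<Rightarrow> ('v, 'v) tensor) \<Rightarrow> nat \<Rightarrow>
    'v family \<Rightarrow> complex"
  where "q_trace \<sigma> M A =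
    (THE c. alpha \<sigma> M A M = (\<lambda>x. c *\<^sub>C Id_on_space (S_pow \<sigma> M) x))"

end

theory Submission
  imports Defs
begin

text \<open>Since \<open>dim S\<^sup>M = 1\<close>, composition on \<open>End S\<^sup>M\<close> is multiplication of scalars, so the q-trace is
  multiplicative as soon as \<open>\<alpha>(A \<times> B) = \<alpha>(A) \<circ> \<alpha>(B)\<close>, that is, as soon as \<open>\<alpha>\<close> is onto.  It is,
  because \<open>\<alpha>(A)\<^sub>p\<close> is \<open>A\<^sub>p\<close> plus terms in the \<open>A\<^sub>l\<close> with \<open>l < p\<close>, which determines a preimage degree by
  degree.

  What has to be checked is that the convolution product is well defined on the spaces \<open>S\<^sup>p\<close>.  This
  is the double factorization of \<open>A\<^bsup>(i+j)\<^esup>\<close> through \<open>A\<^bsup>(i)\<^esup> \<otimes> A\<^bsup>(j)\<^esup>\<close>, with the shuffles on the left and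
  with their inverses on the right.  It needs Matsumoto's theorem that \<open>T\<^sub>w\<close> does not
  depend on the reduced word, obtained here from the description of length as number of inversions.\<close>

section \<open>Reduced words in the symmetric group\<close>

text \<open>The two factorizations serve opposite ends. With the shuffles acting last,
  \<open>sh\<close> sends \<open>A_op \<sigma> i a \<otimes> A_op \<sigma> j b\<close> to
  \<open>A_op \<sigma> (i + j) (a \<cdot> b)\<close>, so the product stays inside the symmetric
  powers. With the block permutations acting last, every value of
  \<open>A_op \<sigma> (i + j)\<close> in degree i + j is a value of A^(i) \<otimes> A^(j), so
  deconcatenation stays inside. Factoring permutations does not settle this by itself: in general
  \<open>T_op\<close> is multiplicative only where lengths add, hence the counting of inversions. A
  second obstacle is that elements of \<open>End U\<close> vanish off \<open>U\<close> and are not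
  linear on the ambient space, while a tensor product of maps is built from globally linear ones;
  linear extensions bridge the gap. Finally, \<open>alpha_inv\<close> chooses preimages on the image
  of \<open>alpha\<close>, so surjectivity is what turns the third product back into
  composition.\<close>

definition wordprod :: "(nat \<Rightarrow> 'a \<Rightarrow> 'a) \<Rightarrow> nat list \<Rightarrow> 'a \<Rightarrow> 'a"
  where "wordprod s is = foldr (\<lambda>i f. s i \<circ> f) is id"

lemma wordprod_simps [simp]:
  "wordprod s [] = id"
  "wordprod s (i # is) = s i \<circ> wordprod s is"
  by (simp_all add: wordprod_def)

lemma wordprod_append: "wordprod s (is @ js) = wordprod s is \<circ> wordprod s js"
  by (induction "is") (simp_all add: comp_assoc)

lemma perm_of_word_eq_wordprod: "perm_of_word = wordprod (\<lambda>i. transpose i (Suc i))"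
  by (simp add: fun_eq_iff perm_of_word_def wordprod_def)

lemma perm_of_word_simps [simp]:
  "perm_of_word [] = id"
  "perm_of_word (i # is) = transpose i (Suc i) \<circ> perm_of_word is"
  by (simp_all add: perm_of_word_eq_wordprod)

lemma perm_of_word_append: "perm_of_word (is @ js) = perm_of_word is \<circ> perm_of_word js"
  by (simp add: perm_of_word_eq_wordprod wordprod_append)

lemma perm_of_word_permutes:
  assumes "set is \<subseteq> {1..<p}"
  shows "perm_of_word is permutes {1..p}"
  using assms
proof (induction "is")
  case Nil
  show ?case unfolding perm_of_word_simps by (rule permutes_id)
next
  case (Cons i "is")
  then have "transpose i (Suc i) \<circ> perm_of_word is permutes {1..p}"
    by (intro permutes_compose permutes_swap_id) auto
  then show ?case unfolding perm_of_word_simps .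
qed

section \<open>Length as number of inversions\<close>

definition inversions :: "(nat \<Rightarrow> nat) \<Rightarrow> (nat \<times> nat) set"
  where "inversions w = {(a, b). a < b \<and> w b < w a}"

lemma inversions_id [simp]: "inversions id = {}" "inversions (\<lambda>x. x) = {}"
  by (auto simp: inversions_def)

text \<open>Pairs range over all naturals, so that \<open>inversions\<close> does not depend on p.
  Both members of an inversion lie in {1..p} because 0 and the points beyond p are fixed and all
  other values stay between them.\<close>

lemma finite_inversions:
  assumes "w permutes {1..p}"
  shows "finite (inversions w)"
proof (rule finite_subset)
  show "inversions w \<subseteq> {1..p} \<times> {1..p}"
  proof clarify
    fix a b assume "(a, b) \<in> inversions w"
    then have *: "a < b" "w b < w a" by (auto simp: inversions_def)
    have fixed: "w x = x" if "x \<notin> {1..p}" for x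
      using assms that by (meson permutes_not_in)
    have into: "w x \<in> {1..p} \<longleftrightarrow> x \<in> {1..p}" for x
      using assms by (rule permutes_in_image)
    show "a \<in> {1..p} \<and> b \<in> {1..p}"
      using * fixed[of a] fixed[of b] into[of a] into[of b] by auto
  qed
qed auto

text \<open>Multiplying on the left exchanges the values i and i + 1, so the pair affected is the
  pair of their positions; this is why ascents and descents are read from \<open>inv w\<close>
  throughout.\<close>

lemma inversions_ascent:
  assumes "bij w" "inv w i < inv w (Suc i)"
  shows "inversions (transpose i (Suc i) \<circ> w) = insert (inv w i, inv w (Suc i)) (inversions w)"
    and "(inv w i, inv w (Suc i)) \<notin> inversions w"
proof -
  have eq: "w c = i \<longleftrightarrow> c = inv w i" "w c = Suc i \<longleftrightarrow> c = inv w (Suc i)" for c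
    using assms(1) by (auto simp: bij_inv_eq_iff)
  have w: "w (inv w i) = i" "w (inv w (Suc i)) = Suc i"
    using eq by auto
  \<comment> \<open>No value lies strictly between i and i + 1, so exchanging them alters no
    comparison with a third value.\<close>
  have ltSuc: "Suc i < x \<longleftrightarrow> i < x" if "x \<noteq> Suc i" for x
    using that by auto
  have Sucgt: "x < Suc i \<longleftrightarrow> x < i" if "x \<noteq> i" for x
    using that by auto
  show "inversions (transpose i (Suc i) \<circ> w) = insert (inv w i, inv w (Suc i)) (inversions w)"
    using assms(2) by (auto simp: inversions_def transpose_def eq w ltSuc Sucgt split: if_splits)
  show "(inv w i, inv w (Suc i)) \<notin> inversions w"
    by (simp add: inversions_def w)
qed

lemma inv_transpose_comp:
  assumes "bij w"
  shows "inv (transpose i j \<circ> w) = inv w \<circ> transpose i j"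
  using assms by (simp add: o_inv_distrib)

lemma bij_transpose_comp: "bij w \<Longrightarrow> bij (transpose i j \<circ> w)"
  by (simp add: bij_comp)

text \<open>The ascent rule for \<open>transpose i (Suc i) \<circ> w\<close>, read backwards, since
  the transposition is an involution.\<close>

lemma inversions_descent:
  assumes "bij w" "inv w (Suc i) < inv w i"
  shows "inversions w = insert (inv w (Suc i), inv w i) (inversions (transpose i (Suc i) \<circ> w))"
    and "(inv w (Suc i), inv w i) \<notin> inversions (transpose i (Suc i) \<circ> w)"
  using inversions_ascent[of "transpose i (Suc i) \<circ> w" i] assms
  by (simp_all add: inv_transpose_comp bij_transpose_comp comp_assoc[symmetric])

lemma card_inversions_ascent:
  assumes "bij w" "finite (inversions w)" "inv w i < inv w (Suc i)"
  shows "card (inversions (transpose i (Suc i) \<circ> w)) = Suc (card (inversions w))"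
  using inversions_ascent[OF assms(1,3)] assms(2) by simp

lemma card_inversions_descent:
  assumes "bij w" "finite (inversions w)" "inv w (Suc i) < inv w i"
  shows "card (inversions w) = Suc (card (inversions (transpose i (Suc i) \<circ> w)))"
  by (metis (no_types, lifting) assms card_insert_disjoint finite_insert inversions_descent)

lemma inv_neq: "bij w \<Longrightarrow> inv w i \<noteq> inv w (Suc i)" for w :: "nat \<Rightarrow> nat"
  by (metis bij_inv_eq_iff n_not_Suc_n)

lemma card_inversions_perm_of_word_le:
  assumes "set is \<subseteq> {1..<p}"
  shows "card (inversions (perm_of_word is)) \<le> length is"
  using assms
proof (induction "is")
  case Nil
  then show ?case by simp
next
  case (Cons i "is")
  let ?w = "perm_of_word is"
  have w: "bij ?w" "finite (inversions ?w)"
    using perm_of_word_permutes[of "is" p] Cons.prems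
    by (auto intro: permutes_bij finite_inversions)
  have IH: "card (inversions ?w) \<le> length is" using Cons by simp
  have "card (inversions (transpose i (Suc i) \<circ> ?w)) \<le> Suc (length is)"
  proof (cases "inv ?w i < inv ?w (Suc i)")
    case True
    then show ?thesis using card_inversions_ascent[OF w] IH by simp
  next
    case False
    then have "inv ?w (Suc i) < inv ?w i" using inv_neq[OF w(1), of i] by simp
    then show ?thesis using card_inversions_descent[OF w] IH by simp
  qed
  then show ?case by (simp only: perm_of_word_simps list.size add_Suc_right add_0_right)
qed

text \<open>Without a descent \<open>inv w\<close> is strictly increasing on all naturals, and a
  strictly increasing bijection of the naturals is the identity.\<close>

lemma exists_descent:
  assumes w: "w permutes {1..p}" and "w \<noteq> id"
  shows "\<exists>i\<in>{1..<p}. inv w (Suc i) < inv w i"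
proof (rule ccontr)
  assume none: "\<not> ?thesis"
  have v: "inv w permutes {1..p}"
    using w by (rule permutes_inv)
  have into: "inv w x \<in> {1..p} \<longleftrightarrow> x \<in> {1..p}" for x
    using v by (rule permutes_in_image)
  have fixed: "inv w x = x" if "x \<notin> {1..p}" for x
    using v that by (meson permutes_not_in)
  have "inv w i < inv w (Suc i)" for i
  proof (cases "i \<in> {1..<p}")
    case True
    then show ?thesis
      using none inv_neq[OF permutes_bij[OF w], of i] by (meson linorder_neqE_nat)
  next
    case False
    \<comment> \<open>At the ends of {1..p} one of the two points is fixed and the image of the
      other stays on its side.\<close>
    then consider "i = 0" | "i \<ge> p" by fastforce
    then show ?thesis
    proof cases
      case 1
      then show ?thesis using fixed[of 0] into[of "Suc 0"] fixed[of "Suc 0"] by fastforce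
    next
      case 2
      then show ?thesis using fixed[of "Suc i"] into[of i] fixed[of i] by fastforce
    qed
  qed
  then have mono: "strict_mono (inv w)"
    by (simp add: strict_mono_Suc_iff)
  \<comment> \<open>A strictly increasing map of the naturals never falls below its argument; this
    is applied to \<open>inv w\<close> and to \<open>w\<close>.\<close>
  have "inv w x = x" for x
  proof (rule antisym)
    show "x \<le> inv w x" using mono by (rule strict_mono_imp_increasing)
    have "strict_mono w"
      by (rule strict_monoI) (metis mono permutes_inverses(2) strict_mono_less w)
    then have "inv w x \<le> w (inv w x)" by (rule strict_mono_imp_increasing)
    then show "inv w x \<le> x" by (simp add: permutes_inverses[OF w])
  qed
  then have "inv w = id" by auto
  with w \<open>w \<noteq> id\<close> show False
    by (metis inv_id permutes_inv_inv)
qed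

text \<open>Sorting by adjacent exchanges: each descent removed lowers the count by one and
  contributes one letter.\<close>

lemma exists_word_of_inversions_length:
  assumes "w permutes {1..p}"
  shows "\<exists>is. set is \<subseteq> {1..<p} \<and> perm_of_word is = w \<and> length is = card (inversions w)"
  using assms
proof (induction "card (inversions w)" arbitrary: w rule: less_induct)
  case less
  show ?case
  proof (cases "w = id")
    case True
    then show ?thesis by (intro exI[of _ "[]"]) simp
  next
    case False
    then obtain i where i: "i \<in> {1..<p}" "inv w (Suc i) < inv w i"
      using exists_descent[OF less.prems] by blast
    let ?v = "transpose i (Suc i) \<circ> w"
    have card: "card (inversions w) = Suc (card (inversions ?v))"
      using less.prems i(2)
      by (intro card_inversions_descent) (auto intro: permutes_bij finite_inversions)
    moreover have "?v permutes {1..p}"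
      using i less.prems by (auto intro!: permutes_compose permutes_swap_id)
    ultimately obtain "is" where "set is \<subseteq> {1..<p}" "perm_of_word is = ?v"
      "length is = card (inversions ?v)"
      using less.hyps[of ?v] by auto
    with i card show ?thesis
      by (intro exI[of _ "i # is"]) (auto simp: comp_assoc[symmetric])
  qed
qed

text \<open>Trades minimality over all words for a count that can be computed; from here on a word
  is proved reduced by comparing its length with the inversions.\<close>

lemma reduced_word_iff:
  "reduced_word p w is \<longleftrightarrow>
    set is \<subseteq> {1..<p} \<and> perm_of_word is = w \<and> length is = card (inversions w)"
proof
  assume red: "reduced_word p w is"
  then have "w permutes {1..p}"
    using perm_of_word_permutes by (auto simp: reduced_word_def)
  from exists_word_of_inversions_length[OF this] red
  have "length is \<le> card (inversions w)"
    by (auto simp: reduced_word_def)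
  then show "set is \<subseteq> {1..<p} \<and> perm_of_word is = w \<and> length is = card (inversions w)"
    using red card_inversions_perm_of_word_le[of "is" p]
    by (auto simp: reduced_word_def intro: antisym)
next
  assume "set is \<subseteq> {1..<p} \<and> perm_of_word is = w \<and> length is = card (inversions w)"
  then show "reduced_word p w is"
    unfolding reduced_word_def by (metis card_inversions_perm_of_word_le)
qed

lemma reduced_word_permutes: "reduced_word p w is \<Longrightarrow> w permutes {1..p}"
  using perm_of_word_permutes by (auto simp: reduced_word_def)

lemma exists_reduced_word: "w permutes {1..p} \<Longrightarrow> \<exists>is. reduced_word p w is"
  using exists_word_of_inversions_length by (auto simp: reduced_word_iff)

text \<open>The recursion that drives the induction on reduced words: a first letter is admissible
  exactly at a descent of \<open>inv w\<close>.\<close>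

lemma reduced_word_Cons_iff:
  "reduced_word p w (i # is) \<longleftrightarrow>
    i \<in> {1..<p} \<and> reduced_word p (transpose i (Suc i) \<circ> w) is \<and> inv w (Suc i) < inv w i"
  (is "?L \<longleftrightarrow> ?R")
proof
  assume L: ?L
  then have p: "w permutes {1..p}" by (rule reduced_word_permutes)
  have w: "bij w" "finite (inversions w)"
    using p by (auto intro: permutes_bij finite_inversions)
  \<comment> \<open>The tail spells \<open>transpose i (Suc i) \<circ> w\<close>; at an ascent this
    would have two inversions more than the tail has letters.\<close>
  have "card (inversions (transpose i (Suc i) \<circ> w)) \<le> length is"
    using card_inversions_perm_of_word_le[of "is" p] L
    by (auto simp: reduced_word_iff comp_assoc[symmetric])
  then show ?R
    using L card_inversions_ascent[OF w, of i] card_inversions_descent[OF w, of i]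
      inv_neq[OF w(1), of i]
    by (cases "inv w i < inv w (Suc i)") (auto simp: reduced_word_iff comp_assoc[symmetric])
next
  assume R: ?R
  then have "transpose i (Suc i) \<circ> w permutes {1..p}" by (blast dest: reduced_word_permutes)
  moreover have "transpose i (Suc i) permutes {1..p}"
    using R by (intro permutes_swap_id) auto
  ultimately have "transpose i (Suc i) \<circ> (transpose i (Suc i) \<circ> w) permutes {1..p}"
    by (rule permutes_compose)
  then have p: "w permutes {1..p}" by (simp add: comp_assoc[symmetric])
  have w: "bij w" "finite (inversions w)"
    using p by (auto intro: permutes_bij finite_inversions)
  show ?L
    using R card_inversions_descent[OF w, of i]
    by (auto simp: reduced_word_iff comp_assoc[symmetric])
qed

section \<open>Matsumoto's theorem\<close>

locale braid_relations =
  fixes s :: "nat \<Rightarrow> 'a \<Rightarrow> 'a"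
  assumes far: "Suc i < j \<Longrightarrow> s i \<circ> s j = s j \<circ> s i"
    and near: "s i \<circ> s (Suc i) \<circ> s i = s (Suc i) \<circ> s i \<circ> s (Suc i)"
begin

text \<open>Two descents i < j of \<open>inv w\<close> allow the longest element of the group
  generated by both transpositions to be split off on the left. It is spelled once starting with i
  and once starting with j; each spelling shares its first letter with a given word and is compared
  with it by induction, and the two spellings differ by one braid relation.\<close>

lemma wordprod_two_starts:
  assumes "i < j" and i: "reduced_word p w (i # is)" and j: "reduced_word p w (j # js)"
    and IH: "\<And>v is js. reduced_word p v is \<Longrightarrow> reduced_word p v js \<Longrightarrow>
      length is < card (inversions w) \<Longrightarrow> wordprod s is = wordprod s js"
  shows "wordprod s (i # is) = wordprod s (j # js)"
proof -
  have p: "w permutes {1..p}" using i by (rule reduced_word_permutes)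
  then have w: "bij w" by (rule permutes_bij)
  have len: "length is < card (inversions w)" "length js < card (inversions w)"
    using i j by (auto simp: reduced_word_iff)
  have i': "i \<in> {1..<p}" "inv w (Suc i) < inv w i" "reduced_word p (transpose i (Suc i) \<circ> w) is"
    using i by (auto simp: reduced_word_Cons_iff)
  have j': "j \<in> {1..<p}" "inv w (Suc j) < inv w j" "reduced_word p (transpose j (Suc j) \<circ> w) js"
    using j by (auto simp: reduced_word_Cons_iff)
  have sw: "transpose i (Suc i) permutes {1..p}" "transpose j (Suc j) permutes {1..p}"
    using i'(1) j'(1) by (auto intro!: permutes_swap_id)
  show ?thesis
  proof (cases "j = Suc i")
    case False
    \<comment> \<open>Once both commuting transpositions are removed, i and j may be put back in
      either order.\<close>
    let ?u = "transpose j (Suc j) \<circ> (transpose i (Suc i) \<circ> w)"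
    have "?u permutes {1..p}" using sw p by (intro permutes_compose)
    then obtain ks where ks: "reduced_word p ?u ks"
      using exists_reduced_word by blast
    have comm: "transpose i (Suc i) \<circ> (transpose j (Suc j) \<circ> w) = ?u"
      using False \<open>i < j\<close> by (auto simp: fun_eq_iff transpose_def)
    have "reduced_word p (transpose i (Suc i) \<circ> w) (j # ks)"
      using ks j' False \<open>i < j\<close> w by (simp add: reduced_word_Cons_iff inv_transpose_comp)
    moreover have "reduced_word p (transpose j (Suc j) \<circ> w) (i # ks)"
      using ks i' False \<open>i < j\<close> w by (simp add: reduced_word_Cons_iff inv_transpose_comp comm)
    ultimately have "wordprod s is = wordprod s (j # ks)" "wordprod s js = wordprod s (i # ks)"
      using IH i' j' len by blast+
    then show ?thesis
      using far[of i j] False \<open>i < j\<close> by (simp add: comp_assoc[symmetric])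
  next
    case True
    \<comment> \<open>Removes a product of three letters; as i and i + 1 are both descents, each
      removal lowers the length.\<close>
    let ?u = "transpose i (Suc i) \<circ> (transpose j (Suc j) \<circ> (transpose i (Suc i) \<circ> w))"
    have "?u permutes {1..p}" using sw p by (intro permutes_compose)
    then obtain ks where ks: "reduced_word p ?u ks"
      using exists_reduced_word by blast
    \<comment> \<open>Both alternating products of three letters are the transposition of i and i +
      2.\<close>
    have comm: "transpose j (Suc j) \<circ> (transpose i (Suc i) \<circ> (transpose j (Suc j) \<circ> w)) = ?u"
      using transpose_comp_triple[of i "Suc (Suc i)" "Suc i"]
        transpose_comp_triple[of "Suc (Suc i)" i "Suc i"]
      by (simp add: True comp_assoc[symmetric] transpose_commute)
    have "reduced_word p (transpose i (Suc i) \<circ> w) (j # i # ks)"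
      using ks i' j' True w by (simp add: reduced_word_Cons_iff inv_transpose_comp bij_transpose_comp)
    moreover have "reduced_word p (transpose j (Suc j) \<circ> w) (i # j # ks)"
      using ks i' j' w comm unfolding True
      by (simp add: reduced_word_Cons_iff inv_transpose_comp bij_transpose_comp)
    ultimately have "wordprod s is = wordprod s (j # i # ks)"
      "wordprod s js = wordprod s (i # j # ks)"
      using IH i' j' len by blast+
    then show ?thesis
      using near[of i] True by (simp add: comp_assoc[symmetric])
  qed
qed

text \<open>Induction on the common length: equal first letters cancel, and unequal ones are reduced
  to i < j by symmetry.\<close>

theorem wordprod_unique:
  assumes "reduced_word p w is" "reduced_word p w js"
  shows "wordprod s is = wordprod s js"
  using assms
proof (induction "length is" arbitrary: w "is" js rule: less_induct)
  case less
  have len: "length is = length js" "length is = card (inversions w)"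
    using less.prems by (simp_all add: reduced_word_iff)
  have IH: "wordprod s is' = wordprod s js'"
    if "reduced_word p v is'" "reduced_word p v js'" "length is' < card (inversions w)" for v is' js'
    by (rule less.hyps[of is' v js']) (use that len(2) in \<open>auto simp: reduced_word_iff\<close>)
  show ?case
  proof (cases "is")
    case Nil
    then show ?thesis using len by simp
  next
    case (Cons i is')
    then obtain j js' where j: "js = j # js'"
      using len by (cases js) auto
    consider "i = j" | "i < j" | "j < i" by linarith
    then show ?thesis
    proof cases
      case 1
      have "reduced_word p (transpose i (Suc i) \<circ> w) is'"
        "reduced_word p (transpose i (Suc i) \<circ> w) js'"
        using less.prems unfolding Cons j 1 by (blast dest: reduced_word_Cons_iff[THEN iffD1])+
      moreover have "length is' < card (inversions w)" using len Cons by simp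
      ultimately have "wordprod s is' = wordprod s js'" by (rule IH)
      then show ?thesis by (simp add: Cons j 1)
    next
      case 2
      show ?thesis
        unfolding Cons j
        by (rule wordprod_two_starts[OF 2 less.prems[unfolded Cons j] IH])
    next
      case 3
      show ?thesis
        unfolding Cons j
        by (rule wordprod_two_starts[OF 3 less.prems(2,1)[unfolded Cons j] IH, symmetric])
    qed
  qed
qed

end

section \<open>Products with additive length and coset representatives\<close>

lemma card_inversions_comp:
  assumes w: "w permutes {1..p}" and y: "y permutes {1..p}"
    and stay: "\<And>a b. a < b \<Longrightarrow> y b < y a \<Longrightarrow> w (y b) < w (y a)"
  shows "card (inversions (w \<circ> y)) = card (inversions w) + card (inversions y)"
proof -
  let ?f = "map_prod (inv y) (inv y)"
  have yinv: "y (inv y x) = x" "inv y (y x) = x" for x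
    using y by (simp_all add: permutes_inverses)
  \<comment> \<open>In general a pair inverted by \<open>y\<close> could be turned back by
    \<open>w\<close>; \<open>stay\<close> forbids it, so the inversions of \<open>y\<close> survive
    and those of \<open>w\<close>, pulled back along \<open>y\<close>, are added.\<close>
  have "inversions (w \<circ> y) = ?f ` inversions w \<union> inversions y"
  proof (intro equalityI subsetI)
    fix z assume "z \<in> inversions (w \<circ> y)"
    then obtain a b where z: "z = (a, b)" "a < b" "w (y b) < w (y a)"
      by (auto simp: inversions_def)
    show "z \<in> ?f ` inversions w \<union> inversions y"
    proof (cases "y b < y a")
      case True
      then show ?thesis using z by (simp add: inversions_def)
    next
      case False
      then have "y a < y b" using z by (metis linorder_neqE_nat order_less_irrefl)
      then have "(y a, y b) \<in> inversions w" using z by (simp add: inversions_def)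
      then show ?thesis using z(1) yinv
        by (metis UnI1 image_eqI map_prod_simp)
    qed
  next
    fix z assume "z \<in> ?f ` inversions w \<union> inversions y"
    then show "z \<in> inversions (w \<circ> y)"
    proof
      assume "z \<in> ?f ` inversions w"
      then obtain c d where z: "z = (inv y c, inv y d)" and cd: "c < d" "w d < w c"
        by (auto simp: inversions_def)
      \<comment> \<open>Otherwise the pair would be an inversion of \<open>y\<close> that
        \<open>stay\<close> keeps, giving w c < w d.\<close>
      have "\<not> inv y d < inv y c"
        using stay[of "inv y d" "inv y c"] cd by (auto simp: yinv)
      moreover have "inv y c \<noteq> inv y d" using cd yinv by (metis less_irrefl)
      ultimately show ?thesis using z cd by (simp add: inversions_def yinv)
    qed (auto simp: inversions_def stay)
  qed
  moreover have "?f ` inversions w \<inter> inversions y = {}"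
    by (auto simp: inversions_def yinv)
  moreover have "inj_on ?f (inversions w)"
    using permutes_inj[OF permutes_inv[OF y]] by (blast intro: inj_on_subset prod.inj_map)
  ultimately show ?thesis
    by (simp add: card_Un_disjoint finite_inversions[OF w] finite_inversions[OF y] card_image)
qed

text \<open>The Young subgroup S_i x S_j of S_(i+j), given by an invariance condition that makes
  closure under products and inverses immediate; its two factors are recovered in
  \<open>bij_betw_block_perms\<close>.\<close>

definition block_perms :: "nat \<Rightarrow> nat \<Rightarrow> (nat \<Rightarrow> nat) set"
  where "block_perms i j = {y. y permutes {1..i + j} \<and> (\<forall>x. y x \<le> i \<longleftrightarrow> x \<le> i)}"

lemma finite_block_perms [simp]: "finite (block_perms i j)"
  by (rule finite_subset[OF _ finite_permutations[of "{1..i + j}"]]) (auto simp: block_perms_def)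

lemma finite_shuffles_perm [simp]: "finite (shuffles_perm i j)"
  by (rule finite_subset[OF _ finite_permutations[of "{1..i + j}"]]) (auto simp: shuffles_perm_def)

lemma block_perms_comp: "y \<in> block_perms i j \<Longrightarrow> z \<in> block_perms i j \<Longrightarrow> y \<circ> z \<in> block_perms i j"
  by (auto simp: block_perms_def intro: permutes_compose)

lemma block_perms_inv: "y \<in> block_perms i j \<Longrightarrow> inv y \<in> block_perms i j"
  unfolding block_perms_def by (simp add: permutes_inv) (metis permutes_inverses(1))

lemma permutes_eq_id_if_no_inversions:
  assumes "w permutes {1..p}" "inversions w = {}"
  shows "w = id"
  using exists_word_of_inversions_length[OF assms(1)] assms(2) by auto

text \<open>The first block absorbs 0 and the second the points beyond i + j, so inversions, which
  range over all naturals, can be treated without range conditions.\<close>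

lemma shuffles_perm_less:
  assumes "w \<in> shuffles_perm i j" "a < b" "a \<le> i \<longleftrightarrow> b \<le> i"
  shows "w a < w b"
proof -
  have w: "w permutes {1..i + j}" and m: "strict_mono_on {1..i} w" "strict_mono_on {i + 1..i + j} w"
    using assms(1) by (auto simp: shuffles_perm_def)
  have into: "w x \<in> {1..i + j} \<longleftrightarrow> x \<in> {1..i + j}" for x
    using w by (rule permutes_in_image)
  have fixed: "w x = x" if "x \<notin> {1..i + j}" for x
    using w that by (meson permutes_not_in)
  consider "a = 0" | "i + j < b" | "1 \<le> a" "b \<le> i" | "i < a" "b \<le> i + j"
    using assms(2,3) by linarith
  then show ?thesis
  proof cases
    case 1
    then have "w a = 0" "w b \<noteq> 0" using fixed[of a] fixed[of b] into[of b] assms(2) by auto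
    then show ?thesis by simp
  next
    case 2
    then have "w b = b" using fixed[of b] by auto
    moreover have "w a < b"
      using 2 fixed[of a] into[of a] assms(2) by (cases "a \<in> {1..i + j}") auto
    ultimately show ?thesis by simp
  next
    case 3
    then show ?thesis using strict_mono_onD[OF m(1), of a b] assms(2) by simp
  next
    case 4
    then show ?thesis using strict_mono_onD[OF m(2), of a b] assms(2) by simp
  qed
qed

text \<open>Shuffles are the representatives of minimal length of the left cosets of the Young
  subgroup. Two of them in one coset differ by a block permutation without inversions.\<close>

lemma bij_betw_shuffle_block:
  "bij_betw (\<lambda>(w, y). w \<circ> y) (shuffles_perm i j \<times> block_perms i j) {x. x permutes {1..i + j}}"
  unfolding bij_betw_def
proof
  show "inj_on (\<lambda>(w, y). w \<circ> y) (shuffles_perm i j \<times> block_perms i j)"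
  proof (rule inj_onI, clarsimp)
    fix w w' y y'
    assume w: "w \<in> shuffles_perm i j" "w' \<in> shuffles_perm i j"
      and y: "y \<in> block_perms i j" "y' \<in> block_perms i j" and eq: "w \<circ> y = w' \<circ> y'"
    define z where "z = y' \<circ> inv y"
    have z: "z \<in> block_perms i j"
      unfolding z_def using y by (intro block_perms_comp block_perms_inv)
    have yp: "y permutes {1..i + j}" using y by (simp add: block_perms_def)
    have wz: "w = w' \<circ> z"
    proof -
      have "w = (w \<circ> y) \<circ> inv y" by (simp only: comp_assoc permutes_inv_o(1)[OF yp] comp_id)
      then show ?thesis by (simp only: eq z_def comp_assoc)
    qed
    have zi: "z x \<le> i \<longleftrightarrow> x \<le> i" for x
      using z by (simp add: block_perms_def)
    \<comment> \<open>Inside a block both \<open>w = w' \<circ> z\<close> and \<open>w'\<close>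
      increase, so \<open>z\<close> inverts nothing there; across the blocks it keeps the
      sides.\<close>
    have "inversions z = {}"
    proof (rule equals0I, clarsimp simp: inversions_def)
      fix a b assume ab: "a < b" "z b < z a"
      show False
      proof (cases "a \<le> i \<longleftrightarrow> b \<le> i")
        case True
        then have "w a < w b" using shuffles_perm_less w ab by blast
        moreover have "w' (z b) < w' (z a)"
          by (rule shuffles_perm_less[OF w(2) ab(2)]) (simp add: zi True)
        ultimately show False by (simp add: wz)
      next
        case False
        with ab zi[of a] zi[of b] show False by linarith
      qed
    qed
    then have "z = id"
      using z by (intro permutes_eq_id_if_no_inversions) (auto simp: block_perms_def)
    then have "w = w'" using wz by simp
    moreover have "y = y'"
    proof -
      have "z \<circ> y = y'" unfolding z_def by (simp only: comp_assoc permutes_inv_o(2)[OF yp] comp_id)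
      with \<open>z = id\<close> show ?thesis by simp
    qed
    ultimately show "w = w' \<and> y = y'" by simp
  qed
next
  show "(\<lambda>(w, y). w \<circ> y) ` (shuffles_perm i j \<times> block_perms i j) = {x. x permutes {1..i + j}}"
  proof (intro equalityI subsetI)
    fix x assume "x \<in> {x. x permutes {1..i + j}}"
    then have x: "x permutes {1..i + j}" by simp
    \<comment> \<open>Sort \<open>x\<close> on both blocks by the rearrangement inequality.\<close>
    define F where "F y = (\<Sum>k\<in>{1..i + j}. k * x (y k))" for y
    have "id \<in> block_perms i j" using permutes_id by (simp add: block_perms_def)
    then have "block_perms i j \<noteq> {}" by blast
    then have "Max (F ` block_perms i j) \<in> F ` block_perms i j"
      by (intro Max_in) simp_all
    then obtain y where y: "y \<in> block_perms i j" and y_max: "Max (F ` block_perms i j) = F y"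
      by blast
    have max: "F z \<le> F y" if "z \<in> block_perms i j" for z
      unfolding y_max[symmetric] using that by (intro Max_ge) simp_all
    have yp: "y permutes {1..i + j}" using y by (simp add: block_perms_def)
    have less: "x (y a) < x (y b)"
      if ab: "a < b" "a \<in> {1..i + j}" "b \<in> {1..i + j}" "a \<le> i \<longleftrightarrow> b \<le> i" for a b
    proof (rule ccontr)
      assume "\<not> x (y a) < x (y b)"
      moreover have "x (y a) \<noteq> x (y b)"
        using ab x yp by (metis permutes_inverses(2) less_irrefl)
      ultimately have gt: "x (y b) < x (y a)" by simp
      let ?z = "y \<circ> transpose a b"
      let ?R = "{1..i + j} - {a} - {b}"
      have "transpose a b \<in> block_perms i j"
        using ab by (auto simp: block_perms_def transpose_def intro!: permutes_swap_id)
      then have le: "F ?z \<le> F y"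
        using y by (intro max block_perms_comp)
      have split: "(\<Sum>k\<in>{1..i + j}. g k) = g a + (g b + sum g ?R)" for g :: "nat \<Rightarrow> nat"
        using ab by (simp add: sum.remove[of _ a] sum.remove[of _ b])
      \<comment> \<open>Away from a and b the swap changes nothing, so maximality compares two terms
        only; it says x (y a) <= x (y b) up to the positive factor b - a.\<close>
      have "(\<Sum>k\<in>?R. k * x (?z k)) = (\<Sum>k\<in>?R. k * x (y k))"
        by (intro sum.cong) (auto simp: transpose_def)
      with le have "a * x (y b) + b * x (y a) \<le> a * x (y a) + b * x (y b)"
        unfolding F_def split by simp
      moreover obtain c where "b = a + c" "c > 0" using ab(1) less_imp_add_positive by blast
      ultimately have "c * x (y a) \<le> c * x (y b)" by (simp add: algebra_simps)
      with \<open>c > 0\<close> gt show False by simp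
    qed
    have "x \<circ> y \<in> shuffles_perm i j"
      unfolding shuffles_perm_def strict_mono_on_def
      using less permutes_compose[OF yp x] by simp
    moreover have "(x \<circ> y) \<circ> inv y = x"
      by (simp only: comp_assoc permutes_inv_o(1)[OF yp] comp_id)
    ultimately show "x \<in> (\<lambda>(w, y). w \<circ> y) ` (shuffles_perm i j \<times> block_perms i j)"
      using block_perms_inv[OF y]
      by (intro image_eqI[where x = "(x \<circ> y, inv y)"] SigmaI) (simp_all only: prod.case)
  next
    fix x assume "x \<in> (\<lambda>(w, y). w \<circ> y) ` (shuffles_perm i j \<times> block_perms i j)"
    then obtain w y where "w \<in> shuffles_perm i j" "y \<in> block_perms i j" and x: "x = w \<circ> y"
      by (elim imageE SigmaE) (simp only: prod.case)
    then have "w permutes {1..i + j}" "y permutes {1..i + j}"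
      unfolding shuffles_perm_def block_perms_def mem_Collect_eq by blast+
    then show "x \<in> {x. x permutes {1..i + j}}"
      unfolding x mem_Collect_eq by (intro permutes_compose)
  qed
qed

text \<open>The inversions of \<open>y\<close> lie within a block, where \<open>w\<close> is
  increasing.\<close>

lemma card_inversions_shuffle_block:
  assumes w: "w \<in> shuffles_perm i j" and y: "y \<in> block_perms i j"
  shows "card (inversions (w \<circ> y)) = card (inversions w) + card (inversions y)"
proof (rule card_inversions_comp)
  show "w permutes {1..i + j}" "y permutes {1..i + j}"
    using w y by (auto simp: shuffles_perm_def block_perms_def)
  fix a b assume ab: "a < b" "y b < y a"
  have yi: "y x \<le> i \<longleftrightarrow> x \<le> i" for x using y by (simp add: block_perms_def)
  show "w (y b) < w (y a)"
    by (rule shuffles_perm_less[OF w ab(2)]) (use ab yi[of a] yi[of b] in linarith)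
qed

text \<open>The inversions of \<open>inv w\<close> straddle the blocks, since \<open>w\<close>
  increases within each; \<open>y\<close> keeps the two sides apart.\<close>

lemma card_inversions_block_inv_shuffle:
  assumes w: "w \<in> shuffles_perm i j" and y: "y \<in> block_perms i j"
  shows "card (inversions (y \<circ> inv w)) = card (inversions y) + card (inversions (inv w))"
proof (rule card_inversions_comp)
  show wp: "inv w permutes {1..i + j}" and "y permutes {1..i + j}"
    using w y by (auto simp: shuffles_perm_def block_perms_def permutes_inv)
  fix a b assume ab: "a < b" "inv w b < inv w a"
  have yi: "y x \<le> i \<longleftrightarrow> x \<le> i" for x using y by (simp add: block_perms_def)
  have ww: "w (inv w x) = x" for x
    using w by (auto simp: shuffles_perm_def permutes_inverses)
  have "\<not> (inv w b \<le> i \<longleftrightarrow> inv w a \<le> i)"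
    using shuffles_perm_less[OF w ab(2)] ab(1) by (auto simp: ww)
  then show "y (inv w b) < y (inv w a)"
    using ab(2) yi[of "inv w a"] yi[of "inv w b"] by linarith
qed

section \<open>The two factors of the Young subgroup\<close>

definition shift_perm :: "nat \<Rightarrow> (nat \<Rightarrow> nat) \<Rightarrow> nat \<Rightarrow> nat"
  where "shift_perm n v x = (if n < x then v (x - n) + n else x)"

lemma perm_of_word_shift:
  assumes "set is \<subseteq> {1..<p}"
  shows "perm_of_word (map ((+) n) is) = shift_perm n (perm_of_word is)"
  using assms
proof (induction "is")
  case Nil
  then show ?case by (auto simp: shift_perm_def)
next
  case (Cons k "is")
  \<comment> \<open>Positive arguments stay positive, so a point above n never falls back to n,
    where \<open>shift_perm\<close> is the identity.\<close>
  have "perm_of_word is x \<ge> 1" if "x \<ge> 1" for x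
    using permutes_in_image[OF perm_of_word_permutes, of "is" p x]
      permutes_not_in[OF perm_of_word_permutes, of "is" p x] Cons.prems that by auto
  then have "perm_of_word is (x - n) \<ge> 1" if "n < x" for x
    using that by simp
  then show ?case using Cons by (auto simp: fun_eq_iff shift_perm_def transpose_def)
qed

lemma shift_perm_permutes:
  assumes "v permutes {1..j}"
  shows "shift_perm i v permutes {i + 1..i + j}"
proof -
  obtain "is" where word: "set is \<subseteq> {1..<j}" "v = perm_of_word is"
    using exists_reduced_word[OF assms] by (auto simp: reduced_word_def)
  \<comment> \<open>Bijectivity is inherited from the shifted word, a product of
    transpositions.\<close>
  have "bij (shift_perm i v)"
  proof -
    have "set (map ((+) i) is) \<subseteq> {1..<i + j}" using word by auto
    from permutes_bij[OF perm_of_word_permutes[OF this]] show ?thesis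
      by (simp add: perm_of_word_shift[OF word(1)] word(2))
  qed
  moreover have "shift_perm i v x = x" if "x \<notin> {i + 1..i + j}" for x
  proof (cases "i < x")
    case True
    then have "x - i \<notin> {1..j}" using that by auto
    then show ?thesis
      using True permutes_not_in[OF assms, of "x - i"] by (simp add: shift_perm_def)
  qed (simp add: shift_perm_def)
  ultimately show ?thesis by (simp add: permutes_def bij_iff)
qed

text \<open>The reverse inequality is the word-length bound in \<open>reduced_word_shift\<close>,
  which squeezes the count.\<close>

lemma card_inversions_shift:
  "card (inversions (shift_perm n v)) \<ge> card (inversions v)" if "v permutes {1..p}"
proof -
  have v0: "v x = 0 \<longleftrightarrow> x = 0" for x
    using permutes_in_image[OF that, of x] permutes_not_in[OF that, of x]
    by (cases "x \<in> {1..p}") auto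
  have "map_prod ((+) n) ((+) n) ` inversions v \<subseteq> inversions (shift_perm n v)"
  proof (rule image_subsetI)
    fix z assume "z \<in> inversions v"
    then obtain a b where z: "z = (a, b)" and ab: "a < b" "v b < v a"
      by (auto simp: inversions_def)
    \<comment> \<open>\<open>v\<close> fixes 0, so the first position is positive and its translate
      lies above n, where \<open>shift_perm\<close> acts through \<open>v\<close>.\<close>
    then have "0 < a" using v0[of a] by (metis gr0I not_less_zero)
    then show "map_prod ((+) n) ((+) n) z \<in> inversions (shift_perm n v)"
      using ab by (simp add: z inversions_def shift_perm_def)
  qed
  moreover have "finite (inversions (shift_perm n v))"
    by (rule finite_inversions[of _ "n + p"], rule permutes_subset[OF shift_perm_permutes[OF that]])
      auto
  moreover have "inj_on (map_prod ((+) n) ((+) n)) (inversions v)"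
    by (auto simp: inj_on_def)
  ultimately show ?thesis
    by (metis card_image card_mono)
qed

lemma reduced_word_shift:
  assumes "reduced_word p v is"
  shows "reduced_word (n + p) (shift_perm n v) (map ((+) n) is)"
proof -
  have sub: "set is \<subseteq> {1..<p}" and v: "perm_of_word is = v" "length is = card (inversions v)"
    using assms by (auto simp: reduced_word_iff)
  have sub': "set (map ((+) n) is) \<subseteq> {1..<n + p}" using sub by auto
  have eq: "perm_of_word (map ((+) n) is) = shift_perm n v"
    using perm_of_word_shift[OF sub] v by simp
  have "card (inversions (shift_perm n v)) = length is"
    using card_inversions_perm_of_word_le[OF sub'] eq v(2)
      card_inversions_shift[OF reduced_word_permutes[OF assms], of n] by simp
  with sub' eq show ?thesis by (simp add: reduced_word_iff)
qed

lemma reduced_word_mono: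
  assumes "reduced_word p w is" "p \<le> q"
  shows "reduced_word q w is"
  using assms by (force simp: reduced_word_iff)

text \<open>All inversions of \<open>shift_perm i v\<close> and their images lie above i, where
  \<open>u\<close> is the identity.\<close>

lemma card_inversions_comp_shift:
  assumes u: "u permutes {1..i}" and v: "v permutes {1..j}"
  shows "card (inversions (u \<circ> shift_perm i v)) =
    card (inversions u) + card (inversions (shift_perm i v))"
proof (rule card_inversions_comp)
  show "u permutes {1..i + j}" using u by (rule permutes_subset) auto
  have sv: "shift_perm i v permutes {i + 1..i + j}" using v by (rule shift_perm_permutes)
  then show "shift_perm i v permutes {1..i + j}" by (rule permutes_subset) auto
  have fixed: "u x = x" if "i < x" for x
    using permutes_not_in[OF u, of x] that by auto
  fix a b :: nat assume ab: "a < b" "shift_perm i v b < shift_perm i v a"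
  have gt: "i < shift_perm i v x" if "i < x" for x
    using that permutes_in_image[OF sv, of x] permutes_not_in[OF sv, of x] by fastforce
  have "i < a" using ab gt[of b] by (cases "i < b") (auto simp: shift_perm_def split: if_splits)
  then show "u (shift_perm i v b) < u (shift_perm i v a)"
    using fixed gt ab by simp
qed

lemma bij_betw_block_perms:
  "bij_betw (\<lambda>(u, v). u \<circ> shift_perm i v) ({u. u permutes {1..i}} \<times> {v. v permutes {1..j}})
    (block_perms i j)"
  unfolding bij_betw_def
proof
  let ?P = "{u. u permutes {1..i}} \<times> {v. v permutes {1..j}}"
  show "inj_on (\<lambda>(u, v). u \<circ> shift_perm i v) ?P"
  proof (rule inj_onI, clarify)
    fix u v u' v'
    assume u: "u permutes {1..i}" "u' permutes {1..i}"
      and v: "v permutes {1..j}" "v' permutes {1..j}"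
      and eq: "u \<circ> shift_perm i v = u' \<circ> shift_perm i v'"
    have "u x = u' x" for x
    proof (cases "x \<le> i")
      case True
      then show ?thesis using fun_cong[OF eq, of x] by (simp add: shift_perm_def)
    next
      case False
      then show ?thesis
        using permutes_not_in[OF u(1), of x] permutes_not_in[OF u(2), of x] by auto
    qed
    then have uu: "u = u'" by auto
    have shift: "shift_perm i v = shift_perm i v'"
      using eq u(1) unfolding uu[symmetric] by (metis comp_assoc id_comp permutes_inv_o(2))
    \<comment> \<open>The translate x + i lies above i only for positive x; 0 is treated on its
      own.\<close>
    have "v x = v' x" if "x \<noteq> 0" for x
      using that fun_cong[OF shift, of "x + i"] by (simp add: shift_perm_def)
    moreover have "v 0 = v' 0"
      using permutes_not_in[OF v(1), of 0] permutes_not_in[OF v(2), of 0] by simp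
    ultimately have "v = v'" by (metis ext)
    with uu show "u = u' \<and> v = v'" ..
  qed
  show "(\<lambda>(u, v). u \<circ> shift_perm i v) ` ?P = block_perms i j"
  proof (intro equalityI subsetI)
    fix y assume "y \<in> (\<lambda>(u, v). u \<circ> shift_perm i v) ` ?P"
    then obtain u v where u: "u permutes {1..i}" and v: "v permutes {1..j}"
      and y: "y = u \<circ> shift_perm i v" by auto
    have sv: "shift_perm i v permutes {i + 1..i + j}" using v by (rule shift_perm_permutes)
    have "y permutes {1..i + j}"
      unfolding y using u sv by (intro permutes_compose) (auto elim: permutes_subset)
    moreover have "u x \<le> i \<longleftrightarrow> x \<le> i" for x
      using permutes_in_image[OF u, of x] permutes_not_in[OF u, of x] by fastforce
    moreover have "shift_perm i v x \<le> i \<longleftrightarrow> x \<le> i" for x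
      using permutes_in_image[OF sv, of x] permutes_not_in[OF sv, of x] by fastforce
    ultimately show "y \<in> block_perms i j" by (simp add: block_perms_def y)
  next
    fix y assume y: "y \<in> block_perms i j"
    then have yp: "y permutes {1..i + j}" and yi: "\<And>x. y x \<le> i \<longleftrightarrow> x \<le> i"
      by (auto simp: block_perms_def)
    have inj: "y a = y b \<longleftrightarrow> a = b" for a b using yp by (metis permutes_inverses(2))
    have into: "y x \<in> {1..i + j} \<longleftrightarrow> x \<in> {1..i + j}" for x
      using yp by (rule permutes_in_image)
    \<comment> \<open>The restrictions of \<open>y\<close> to the two blocks, the second moved down
      by i.\<close>
    define u where "u x = (if x \<in> {1..i} then y x else x)" for x
    define v where "v x = (if x \<in> {1..j} then y (x + i) - i else x)" for x
    have yv: "y (x + i) \<in> {i + 1..i + j}" if "x \<in> {1..j}" for x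
      using that yi[of "x + i"] into[of "x + i"] by auto
    have yu: "y x \<in> {1..i}" if "x \<in> {1..i}" for x
      using that yi[of x] into[of x] by auto
    have "u permutes {1..i}"
    proof (rule bij_imp_permutes)
      have "inj_on u {1..i}" by (auto simp: inj_on_def u_def inj)
      moreover have "u ` {1..i} \<subseteq> {1..i}" using yu by (auto simp: u_def)
      ultimately show "bij_betw u {1..i} {1..i}"
        by (simp add: bij_betw_def endo_inj_surj)
    qed (auto simp: u_def)
    moreover have "v permutes {1..j}"
    proof (rule bij_imp_permutes)
      have "inj_on v {1..j}"
      proof (rule inj_onI)
        fix a b assume "a \<in> {1..j}" "b \<in> {1..j}" "v a = v b"
        then have "y (a + i) = y (b + i)"
          using yv[of a] yv[of b] by (auto simp: v_def)
        then show "a = b" by (simp add: inj)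
      qed
      moreover have "v ` {1..j} \<subseteq> {1..j}" using yv by (fastforce simp: v_def)
      ultimately show "bij_betw v {1..j} {1..j}"
        by (simp add: bij_betw_def endo_inj_surj)
    qed (auto simp: v_def)
    moreover have "y = u \<circ> shift_perm i v"
    proof
      fix x
      consider "x = 0" | "x \<in> {1..i}" | "x \<in> {i + 1..i + j}" | "i + j < x" by fastforce
      then show "y x = (u \<circ> shift_perm i v) x"
      proof cases
        case 3
        then show ?thesis using yv[of "x - i"] by (auto simp: u_def v_def shift_perm_def)
      qed (use permutes_not_in[OF yp, of x] in \<open>auto simp: u_def v_def shift_perm_def\<close>)
    qed
    ultimately show "y \<in> (\<lambda>(u, v). u \<circ> shift_perm i v) ` ?P" by auto
  qed
qed

section \<open>The tensor algebra\<close>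

global_interpretation cpair: vector_space_pair
  "scaleC :: complex \<Rightarrow> 'a \<Rightarrow> 'a::complex_vector" "scaleC :: complex \<Rightarrow> 'b \<Rightarrow> 'b::complex_vector"
  ..

lemma clinear_simps:
  assumes "clinear f"
  shows "f (x + y) = f x + f y" "f (c *\<^sub>C x) = c *\<^sub>C f x" "f 0 = 0" "f (sum g A) = (\<Sum>a\<in>A. f (g a))"
  using assms by (simp_all add: cpair.linear_add cpair.linear_scale cpair.linear_0 cpair.linear_sum)

lemma clinear_compose: "clinear f \<Longrightarrow> clinear g \<Longrightarrow> clinear (\<lambda>x. g (f x))"
  by (rule clinearI) (simp_all add: clinear_simps)

lemma clinear_add_fun: "clinear f \<Longrightarrow> clinear g \<Longrightarrow> clinear (\<lambda>x. f x + g x)"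
  by (rule clinearI) (simp_all add: clinear_simps scaleC_add_right algebra_simps)

lemma clinear_scaleC_fun: "clinear f \<Longrightarrow> clinear (\<lambda>x. c *\<^sub>C f x)"
  by (rule clinearI) (simp_all add: clinear_simps scaleC_add_right scaleC_scaleC mult.commute)

lemma clinear_zero: "clinear (\<lambda>x. 0)"
  by (rule clinearI) simp_all

lemma clinear_id: "clinear (\<lambda>x. x)"
  by (rule clinearI) simp_all

lemma clinear_sum_fun: "(\<And>a. a \<in> A \<Longrightarrow> clinear (f a)) \<Longrightarrow> clinear (\<lambda>x. \<Sum>a\<in>A. f a x)"
  by (induction A rule: infinite_finite_induct) (simp_all add: clinear_zero clinear_add_fun)

lemma clinear_eq_on_span:
  "clinear f \<Longrightarrow> clinear g \<Longrightarrow> (\<And>b. b \<in> B \<Longrightarrow> f b = g b) \<Longrightarrow> x \<in> cvec.span B \<Longrightarrow> f x = g x"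
  by (rule cpair.linear_eq_on)

lemma clinear_image_span_subset:
  assumes f: "clinear f" and U: "cvec.subspace U" and B: "\<And>b. b \<in> B \<Longrightarrow> f b \<in> U"
    and x: "x \<in> cvec.span B"
  shows "f x \<in> U"
  using x
proof (induction rule: cvec.span_induct_alt)
  case base
  then show ?case using U by (simp add: clinear_simps[OF f] cvec.subspace_0)
next
  case (step c b y)
  then show ?case using U B
    by (simp add: clinear_simps[OF f] cvec.subspace_add cvec.subspace_scale)
qed

lemma clinear_image_subspace: "clinear f \<Longrightarrow> cvec.subspace U \<Longrightarrow> cvec.subspace (f ` U)"
  by (rule cpair.linear_subspace_image)

lemma tens_add_left: "(x + x') \<otimes> y = x \<otimes> y + x' \<otimes> y"
  by transfer (rule cvec.span_base, unfold tensor_relations_def diff_diff_add, blast)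

lemma tens_add_right: "x \<otimes> (y + y') = x \<otimes> y + x \<otimes> y'"
  by transfer (rule cvec.span_base, unfold tensor_relations_def diff_diff_add, blast)

lemma tens_scale_left: "(c *\<^sub>C x) \<otimes> y = c *\<^sub>C (x \<otimes> y)"
  by transfer (rule cvec.span_base, unfold tensor_relations_def, blast)

lemma tens_scale_right: "x \<otimes> (c *\<^sub>C y) = c *\<^sub>C (x \<otimes> y)"
  by transfer (rule cvec.span_base, unfold tensor_relations_def, blast)

lemma clinear_tens_left: "clinear (\<lambda>x. x \<otimes> y)"
  by (rule clinearI) (simp_all add: tens_add_left tens_scale_left)

lemma clinear_tens_right: "clinear (\<lambda>y. x \<otimes> y)"
  by (rule clinearI) (simp_all add: tens_add_right tens_scale_right)

lemma tensor_span: "t \<in> cvec.span {x \<otimes> y | x y. True}"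
proof -
  obtain f where f: "t = abs_tensor f"
    by (metis Quotient3_abs_rep[OF Quotient3_tensor])
  have "f \<in> cvec.span (range gen)" by (rule free_span)
  then have "abs_tensor f \<in> cvec.span {x \<otimes> y | x y. True}"
  proof (induction rule: cvec.span_induct_alt)
    case base
    then show ?case by (simp add: zero_tensor_def[symmetric] cvec.span_zero)
  next
    case (step c b y)
    then obtain v w where b: "b = gen (v, w)" by auto
    have "abs_tensor (c *\<^sub>C b + y) = c *\<^sub>C (v \<otimes> w) + abs_tensor y"
      by (simp add: b tens.abs_eq scaleC_tensor.abs_eq plus_tensor.abs_eq)
    then show ?case
      using step.IH by (auto intro!: cvec.span_add cvec.span_scale intro: cvec.span_base)
  qed
  then show ?thesis by (simp add: f)
qed

lemma clinear_eq_on_tens: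
  assumes "clinear f" "clinear g" "\<And>x y. f (x \<otimes> y) = g (x \<otimes> y)"
  shows "f t = g t"
  by (rule clinear_eq_on_span[OF assms(1,2) _ tensor_span]) (use assms(3) in auto)

lemma word_add: "word (us @ (x + y) # ws) = word (us @ x # ws) + word (us @ y # ws)"
proof transfer
  fix us ws and x y :: 'a
  have "gen (us @ [x + y] @ ws) - gen (us @ [x] @ ws) - gen (us @ [y] @ ws)
      \<in> (tensor_algebra_relations :: ('a list \<Rightarrow>\<^sub>0 complex) set)"
    unfolding tensor_algebra_relations_def by blast
  from cvec.span_base[OF this]
  show "gen (us @ (x + y) # ws) - (gen (us @ x # ws) + gen (us @ y # ws))
      \<in> cvec.span (tensor_algebra_relations :: ('a list \<Rightarrow>\<^sub>0 complex) set)"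
    by (simp add: diff_diff_add)
qed

lemma word_scale: "word (us @ (c *\<^sub>C x) # ws) = c *\<^sub>C word (us @ x # ws)"
proof transfer
  fix us ws and x :: 'a and c
  have "gen (us @ [c *\<^sub>C x] @ ws) - c *\<^sub>C gen (us @ [x] @ ws)
      \<in> (tensor_algebra_relations :: ('a list \<Rightarrow>\<^sub>0 complex) set)"
    unfolding tensor_algebra_relations_def by blast
  from cvec.span_base[OF this]
  show "gen (us @ (c *\<^sub>C x) # ws) - c *\<^sub>C gen (us @ x # ws)
      \<in> cvec.span (tensor_algebra_relations :: ('a list \<Rightarrow>\<^sub>0 complex) set)"
    by simp
qed

lemma clinear_word: "clinear (\<lambda>x. word (us @ x # ws))"
  by (rule clinearI) (simp_all add: word_add word_scale)

lemma word_span: "t \<in> cvec.span (range word)"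
proof -
  obtain f where f: "t = abs_tensor_algebra f"
    by (metis Quotient3_abs_rep[OF Quotient3_tensor_algebra])
  have "f \<in> cvec.span (range gen)" by (rule free_span)
  then have "abs_tensor_algebra f \<in> cvec.span (range word)"
  proof (induction rule: cvec.span_induct_alt)
    case base
    then show ?case by (simp add: zero_tensor_algebra_def[symmetric] cvec.span_zero)
  next
    case (step c b y)
    then obtain vs where b: "b = gen vs" by auto
    have "abs_tensor_algebra (c *\<^sub>C b + y) = c *\<^sub>C word vs + abs_tensor_algebra y"
      by (simp add: b word.abs_eq scaleC_tensor_algebra.abs_eq plus_tensor_algebra.abs_eq)
    then show ?case
      using step.IH by (auto intro!: cvec.span_add cvec.span_scale intro: cvec.span_base)
  qed
  then show ?thesis by (simp add: f)
qed

lemma clinear_eq_on_words: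
  assumes "clinear f" "clinear g" "\<And>vs. f (word vs) = g (word vs)"
  shows "f t = g t"
  by (rule clinear_eq_on_span[OF assms(1,2) _ word_span]) (use assms(3) in auto)

lemma clinear_eq_on_tpow:
  assumes "clinear f" "clinear g" "\<And>vs. length vs = n \<Longrightarrow> f (word vs) = g (word vs)" "t \<in> tpow n"
  shows "f t = g t"
  by (rule clinear_eq_on_span[OF assms(1,2) _ assms(4)[unfolded tpow_def]]) (use assms(3) in auto)

lemma word_in_tpow: "length vs = n \<Longrightarrow> word vs \<in> tpow n"
  unfolding tpow_def by (rule cvec.span_base) blast

lemma subspace_tpow: "cvec.subspace (tpow n)"
  unfolding tpow_def by (rule cvec.subspace_span)

lemma clinear_tpow_subset:
  assumes "clinear f" "cvec.subspace U" "\<And>vs. length vs = n \<Longrightarrow> f (word vs) \<in> U" "t \<in> tpow n"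
  shows "f t \<in> U"
  by (rule clinear_image_span_subset[OF assms(1,2) _ assms(4)[unfolded tpow_def]]) (use assms(3) in auto)

section \<open>Juxtaposition\<close>

text \<open>The concatenation product of the tensor algebra; with it, operators on some of the
  positions become operators on one factor.\<close>

definition juxt :: "'v::complex_vector tensor_algebra \<Rightarrow> 'v tensor_algebra \<Rightarrow> 'v tensor_algebra"
  (infixr "\<cdot>" 70) where "x \<cdot> y = juxtapose (x \<otimes> y)"

context
begin

private lemma prepend:
  "clinear (word_lift (\<lambda>ws. word (us @ ws)))" "word_lift (\<lambda>ws. word (us @ ws)) (word ws) = word (us @ ws)"
  by (rule word_lift; simp add: clinear_word append_assoc[symmetric] del: append_assoc)+

text \<open>The outer \<open>word_lift\<close> requires linearity in each letter of the prefix while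
  the suffix is already an arbitrary tensor, so both sides are compared on words of the
  suffix.\<close>

private lemma clinear_prepend_letter:
  "clinear (\<lambda>x. word_lift (\<lambda>ws. word ((us @ [x] @ us') @ ws)) y)"
proof (rule clinearI)
  fix x x' :: 'a and c
  show "word_lift (\<lambda>ws. word ((us @ [x + x'] @ us') @ ws)) y =
      word_lift (\<lambda>ws. word ((us @ [x] @ us') @ ws)) y + word_lift (\<lambda>ws. word ((us @ [x'] @ us') @ ws)) y"
    by (rule clinear_eq_on_words[OF prepend(1) clinear_add_fun[OF prepend(1) prepend(1)]])
      (unfold prepend(2), simp add: word_add)
  show "word_lift (\<lambda>ws. word ((us @ [c *\<^sub>C x] @ us') @ ws)) y =
      c *\<^sub>C word_lift (\<lambda>ws. word ((us @ [x] @ us') @ ws)) y"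
    by (rule clinear_eq_on_words[OF prepend(1) clinear_scaleC_fun[OF prepend(1)]])
      (unfold prepend(2), simp add: word_scale)
qed

private lemma concat_left:
  "clinear (word_lift (\<lambda>us. word_lift (\<lambda>ws. word (us @ ws)) y))"
  "word_lift (\<lambda>us. word_lift (\<lambda>ws. word (us @ ws)) y) (word us) = word_lift (\<lambda>ws. word (us @ ws)) y"
  by (rule word_lift, rule clinear_prepend_letter)+

private lemma concat_right:
  "clinear (\<lambda>y. word_lift (\<lambda>us. word_lift (\<lambda>ws. word (us @ ws)) y) x)"
proof (rule clinearI)
  fix y y' :: "'a tensor_algebra" and c
  show "word_lift (\<lambda>us. word_lift (\<lambda>ws. word (us @ ws)) (y + y')) x =
      word_lift (\<lambda>us. word_lift (\<lambda>ws. word (us @ ws)) y) x +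
      word_lift (\<lambda>us. word_lift (\<lambda>ws. word (us @ ws)) y') x"
    by (rule clinear_eq_on_words[OF concat_left(1) clinear_add_fun[OF concat_left(1) concat_left(1)]])
      (unfold concat_left(2), simp add: clinear_simps[OF prepend(1)])
  show "word_lift (\<lambda>us. word_lift (\<lambda>ws. word (us @ ws)) (c *\<^sub>C y)) x =
      c *\<^sub>C word_lift (\<lambda>us. word_lift (\<lambda>ws. word (us @ ws)) y) x"
    by (rule clinear_eq_on_words[OF concat_left(1) clinear_scaleC_fun[OF concat_left(1)]])
      (unfold concat_left(2), simp add: clinear_simps[OF prepend(1)])
qed

lemma clinear_juxtapose: "clinear juxtapose"
  unfolding juxtapose_def by (rule tensor_lift(1)[OF concat_left(1) concat_right])

lemma juxt_word: "word us \<cdot> word ws = word (us @ ws)"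
  unfolding juxt_def juxtapose_def tensor_lift(2)[OF concat_left(1) concat_right] concat_left(2)
  by (rule prepend(2))

end

lemma clinear_juxt_left: "clinear (\<lambda>x. x \<cdot> y)"
  unfolding juxt_def by (rule clinear_compose[OF clinear_tens_left clinear_juxtapose])

lemma clinear_juxt_right: "clinear (\<lambda>y. x \<cdot> y)"
  unfolding juxt_def by (rule clinear_compose[OF clinear_tens_right clinear_juxtapose])

lemmas juxt_simps =
  clinear_simps[OF clinear_juxt_left] clinear_simps[OF clinear_juxt_right]

lemma clinear_juxt_left': "clinear f \<Longrightarrow> clinear (\<lambda>x. f x \<cdot> y)"
  by (rule clinear_compose[OF _ clinear_juxt_left])

lemma clinear_juxt_right': "clinear f \<Longrightarrow> clinear (\<lambda>x. y \<cdot> f x)"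
  by (rule clinear_compose[OF _ clinear_juxt_right])

lemma juxt_assoc: "(x \<cdot> y) \<cdot> z = x \<cdot> y \<cdot> z"
proof (rule clinear_eq_on_words[of "\<lambda>x. (x \<cdot> y) \<cdot> z" "\<lambda>x. x \<cdot> y \<cdot> z"])
  fix us
  show "(word us \<cdot> y) \<cdot> z = word us \<cdot> y \<cdot> z"
  proof (rule clinear_eq_on_words[of "\<lambda>y. (word us \<cdot> y) \<cdot> z" "\<lambda>y. word us \<cdot> y \<cdot> z"])
    fix vs
    show "(word us \<cdot> word vs) \<cdot> z = word us \<cdot> word vs \<cdot> z"
      by (rule clinear_eq_on_words[of "\<lambda>z. (word us \<cdot> word vs) \<cdot> z" "\<lambda>z. word us \<cdot> word vs \<cdot> z"])
        ((intro clinear_juxt_left' clinear_juxt_right' clinear_id)+, simp add: juxt_word)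
  qed (intro clinear_juxt_left' clinear_juxt_right' clinear_id)+
qed (intro clinear_juxt_left' clinear_juxt_right' clinear_id)+

lemma juxt_word_Nil: "x \<cdot> word [] = x"
  by (rule clinear_eq_on_words[OF clinear_juxt_left clinear_id]) (simp add: juxt_word)

text \<open>Reduces an identity in two homogeneous arguments to words of fixed lengths, where the
  place of the cut is explicit.\<close>

lemma juxt_eq_on_tpow:
  assumes a: "a \<in> tpow m" and b: "b \<in> tpow n"
    and f: "clinear f" and g: "\<And>x. clinear (g x)" "\<And>y. clinear (\<lambda>x. g x y)"
    and eq: "\<And>us ws. length us = m \<Longrightarrow> length ws = n \<Longrightarrow> f (word (us @ ws)) = g (word us) (word ws)"
  shows "f (a \<cdot> b) = g a b"
proof (rule clinear_eq_on_tpow[of "\<lambda>a. f (a \<cdot> b)" "\<lambda>a. g a b" m, OF _ g(2) _ a])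
  show "clinear (\<lambda>a. f (a \<cdot> b))" by (rule clinear_compose[OF clinear_juxt_left f])
  fix us :: "'a list" assume us: "length us = m"
  show "f (word us \<cdot> b) = g (word us) b"
    by (rule clinear_eq_on_tpow[of "\<lambda>b. f (word us \<cdot> b)" "g (word us)" n, OF _ g(1) _ b])
      (simp_all add: juxt_word us eq clinear_compose[OF clinear_juxt_right f])
qed

lemma juxt_tpow:
  assumes a: "a \<in> tpow m" and b: "b \<in> tpow n"
  shows "a \<cdot> b \<in> tpow (m + n)"
proof (rule clinear_tpow_subset[OF clinear_juxt_left subspace_tpow _ a])
  fix us :: "'a list" assume us: "length us = m"
  show "word us \<cdot> b \<in> tpow (m + n)"
    by (rule clinear_tpow_subset[OF clinear_juxt_right subspace_tpow _ b])
      (simp add: juxt_word us word_in_tpow)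
qed

lemma
  fixes vs :: "'v::complex_vector list"
  shows clinear_deconc: "clinear (deconc i j :: 'v tensor_algebra \<Rightarrow> _)"
    and deconc_word: "deconc i j (word vs) =
    (if length vs = i + j then word (take i vs) \<otimes> word (drop i vs) else 0)"
proof -
  have "clinear (\<lambda>x :: 'v. if length (us @ [x] @ ws) = i + j
      then word (take i (us @ [x] @ ws)) \<otimes> word (drop i (us @ [x] @ ws)) else 0)" for us ws
  proof (cases "length us + length ws + 1 = i + j")
    case True
    \<comment> \<open>The cut falls after i letters; the variable letter belongs to exactly one of
      the two factors.\<close>
    show ?thesis
    proof (cases "length us < i")
      case True
      then have "clinear (\<lambda>x :: 'v. word (us @ x # take (i - length us - 1) ws) \<otimes> word (drop (i - length us - 1) ws))"
        by (intro clinear_compose[OF clinear_word clinear_tens_left])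
      then show ?thesis
        using \<open>length us + length ws + 1 = i + j\<close> True by (simp add: take_Cons' drop_Cons')
    next
      case False
      then have "clinear (\<lambda>x :: 'v. word (take i us) \<otimes> word (drop i us @ x # ws))"
        by (intro clinear_compose[OF clinear_word clinear_tens_right])
      then show ?thesis
        using \<open>length us + length ws + 1 = i + j\<close> False by simp
    qed
  qed (simp add: clinear_zero)
  from word_lift[OF this]
  show "clinear (deconc i j :: 'v tensor_algebra \<Rightarrow> _)" and "deconc i j (word vs) =
    (if length vs = i + j then word (take i vs) \<otimes> word (drop i vs) else 0)"
    unfolding deconc_def by auto
qed

lemma deconc_juxt:
  assumes "a \<in> tpow i" "b \<in> tpow j"
  shows "deconc i j (a \<cdot> b) = a \<otimes> b"
  by (rule juxt_eq_on_tpow[OF assms clinear_deconc clinear_tens_right clinear_tens_left])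
    (simp add: deconc_word)

section \<open>The braid operators\<close>

text \<open>Identifies the type on which \<open>\<sigma>\<close> acts with degree 2 of the tensor
  algebra.\<close>

definition pair_word :: "('v::complex_vector, 'v) tensor \<Rightarrow> 'v tensor_algebra"
  where "pair_word = tensor_lift (\<lambda>x y. word [x, y])"

lemma
  fixes x y :: "'v::complex_vector"
  shows clinear_pair_word: "clinear (pair_word :: ('v, 'v) tensor \<Rightarrow> _)"
    and pair_word_tens: "pair_word (x \<otimes> y) = word [x, y]"
proof -
  have "clinear (\<lambda>x :: 'v. word [x, y])" "clinear (\<lambda>y :: 'v. word [x, y])" for x y
    using clinear_word[of "[]" "[y]"] clinear_word[of "[x]" "[]"] by simp_all
  from tensor_lift[OF this]
  show "clinear (pair_word :: ('v, 'v) tensor \<Rightarrow> _)" "pair_word (x \<otimes> y) = word [x, y]"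
    unfolding pair_word_def by auto
qed

lemma pair_word_in_tpow: "pair_word t \<in> tpow 2"
  by (rule clinear_image_span_subset[OF clinear_pair_word subspace_tpow _ tensor_span])
    (auto simp: pair_word_tens word_in_tpow)

text \<open>Turns the splicing inside \<open>braid_at\<close> into a product of three factors, so
  that its linearity follows from that of \<open>juxt\<close>.\<close>

lemma tensor_lift_word:
  "tensor_lift (\<lambda>x y. word (us @ [x, y] @ ws)) t = word us \<cdot> pair_word t \<cdot> word ws"
proof (rule clinear_eq_on_tens)
  have lin: "clinear (\<lambda>x :: 'a. word (us @ [x, y] @ ws))" "clinear (\<lambda>y :: 'a. word (us @ [x, y] @ ws))" for x y
    using clinear_word[of us "y # ws"] clinear_word[of "us @ [x]" ws] by simp_all
  show "clinear (tensor_lift (\<lambda>x y :: 'a. word (us @ [x, y] @ ws)))"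
    by (rule tensor_lift(1)[OF lin])
  show "clinear (\<lambda>t. word us \<cdot> pair_word t \<cdot> word ws)"
    by (intro clinear_juxt_left' clinear_juxt_right' clinear_pair_word)
  show "tensor_lift (\<lambda>x y. word (us @ [x, y] @ ws)) (x \<otimes> y) = word us \<cdot> pair_word (x \<otimes> y) \<cdot> word ws"
    for x y by (subst tensor_lift(2)[OF lin]) (simp add: pair_word_tens juxt_word)
qed

lemma
  assumes \<sigma>: "clinear \<sigma>"
  shows clinear_braid_at: "clinear (braid_at \<sigma> i)"
    and braid_at_word: "braid_at \<sigma> i (word vs) =
      (if 1 \<le> i \<and> i < length vs
       then word (take (i - 1) vs) \<cdot> pair_word (\<sigma> (vs ! (i - 1) \<otimes> vs ! i)) \<cdot> word (drop (i + 1) vs)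
       else 0)"
proof -
  let ?g = "\<lambda>vs. if 1 \<le> i \<and> i < length vs
       then word (take (i - 1) vs) \<cdot> pair_word (\<sigma> (vs ! (i - 1) \<otimes> vs ! i)) \<cdot> word (drop (i + 1) vs)
       else 0"
  have eq: "braid_at \<sigma> i = word_lift ?g"
    unfolding braid_at_def tensor_lift_word ..
  have "clinear (\<lambda>x. ?g (us @ [x] @ ws))" for us ws
  proof (cases "1 \<le> i \<and> i < length us + length ws + 1")
    case True
    then obtain k where k: "i = Suc k" by (cases i) auto
    \<comment> \<open>The variable letter lies behind the braided pair, is its second or its first
      member, or lies before it.\<close>
    consider "length us \<ge> k + 2" | "length us = Suc k" | "length us = k" | "length us < k" by linarith
    then show ?thesis
    proof cases
      case 1
      have "clinear (\<lambda>x. word (take k us) \<cdot> pair_word (\<sigma> (us ! k \<otimes> us ! Suc k)) \<cdot> word (drop (k + 2) us @ x # ws))"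
        by (intro clinear_juxt_left' clinear_juxt_right' clinear_word)
      then show ?thesis using True k 1 by (simp add: nth_append)
    next
      case 2
      have "clinear (\<lambda>x. word (take k us) \<cdot> pair_word (\<sigma> (us ! k \<otimes> x)) \<cdot> word ws)"
        by (intro clinear_juxt_left' clinear_juxt_right' clinear_compose[OF _ clinear_pair_word]
          clinear_compose[OF _ \<sigma>] clinear_tens_right)
      then show ?thesis using True k 2 by (simp add: nth_append)
    next
      case 3
      then obtain z zs where ws: "ws = z # zs" using True k by (cases ws) auto
      have "clinear (\<lambda>x. word us \<cdot> pair_word (\<sigma> (x \<otimes> z)) \<cdot> word zs)"
        by (intro clinear_juxt_left' clinear_juxt_right' clinear_compose[OF _ clinear_pair_word]
          clinear_compose[OF _ \<sigma>] clinear_tens_left)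
      then show ?thesis using True k 3 by (simp add: nth_append ws)
    next
      case 4
      define m where "m = k - length us - 1"
      have m: "k = length us + Suc m" using 4 by (simp add: m_def)
      have "clinear (\<lambda>x. word (us @ x # take m ws) \<cdot> pair_word (\<sigma> (ws ! m \<otimes> ws ! Suc m)) \<cdot> word (drop (m + 2) ws))"
        by (intro clinear_juxt_left' clinear_juxt_right' clinear_word)
      then show ?thesis using True k by (simp add: m nth_append numeral_3_eq_3)
    qed
  qed (auto simp: clinear_zero)
  from word_lift[OF this]
  show "clinear (braid_at \<sigma> i)" "braid_at \<sigma> i (word vs) = ?g vs"
    unfolding eq by auto
qed


context
  fixes \<sigma> :: "('v::complex_vector, 'v) tensor \<Rightarrow> ('v, 'v) tensor"
  assumes \<sigma>: "clinear \<sigma>"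
begin

lemma braid_at_eq_0:
  assumes "i = 0 \<or> n \<le> i" "a \<in> tpow n"
  shows "braid_at \<sigma> i a = 0"
  by (rule clinear_eq_on_tpow[OF clinear_braid_at[OF \<sigma>] clinear_zero _ assms(2)])
    (use assms(1) in \<open>auto simp: braid_at_word[OF \<sigma>]\<close>)

lemma braid_at_0: "braid_at \<sigma> 0 x = 0"
  by (rule clinear_eq_on_words[OF clinear_braid_at[OF \<sigma>] clinear_zero])
    (simp add: braid_at_word[OF \<sigma>])

text \<open>Together with its mirror image \<open>braid_at_juxt_right\<close> this is the locality
  of the braid operators, from which the braid relations on all degrees and the block factorization
  follow.\<close>

lemma braid_at_juxt_left:
  assumes "a \<in> tpow n" "i < n"
  shows "braid_at \<sigma> i (a \<cdot> b) = braid_at \<sigma> i a \<cdot> b"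
proof (rule clinear_eq_on_words[of "\<lambda>b. braid_at \<sigma> i (a \<cdot> b)" "\<lambda>b. braid_at \<sigma> i a \<cdot> b"])
  fix ws :: "'v list"
  show "braid_at \<sigma> i (a \<cdot> word ws) = braid_at \<sigma> i a \<cdot> word ws"
  proof (rule clinear_eq_on_tpow[of "\<lambda>a. braid_at \<sigma> i (a \<cdot> word ws)" "\<lambda>a. braid_at \<sigma> i a \<cdot> word ws" n])
    fix us :: "'v list" assume us: "length us = n"
    then show "braid_at \<sigma> i (word us \<cdot> word ws) = braid_at \<sigma> i (word us) \<cdot> word ws"
      using assms(2)
      by (cases i) (simp_all add: juxt_word braid_at_word[OF \<sigma>] nth_append juxt_assoc juxt_simps)
  qed (intro clinear_compose[OF _ clinear_braid_at[OF \<sigma>]] clinear_juxt_left'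
      clinear_juxt_left clinear_braid_at[OF \<sigma>] assms(1))+
qed (intro clinear_compose[OF _ clinear_braid_at[OF \<sigma>]] clinear_juxt_right)+

text \<open>A position i >= 1 of the right factor lies behind the cut; the operator at n itself
  would straddle it.\<close>

lemma braid_at_juxt_right:
  assumes "a \<in> tpow n" "1 \<le> i"
  shows "braid_at \<sigma> (n + i) (a \<cdot> b) = a \<cdot> braid_at \<sigma> i b"
proof (rule clinear_eq_on_words[of "\<lambda>b. braid_at \<sigma> (n + i) (a \<cdot> b)" "\<lambda>b. a \<cdot> braid_at \<sigma> i b"])
  fix ws :: "'v list"
  show "braid_at \<sigma> (n + i) (a \<cdot> word ws) = a \<cdot> braid_at \<sigma> i (word ws)"
  proof (rule clinear_eq_on_tpow[of "\<lambda>a. braid_at \<sigma> (n + i) (a \<cdot> word ws)" "\<lambda>a. a \<cdot> braid_at \<sigma> i (word ws)" n])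
    fix us :: "'v list" assume us: "length us = n"
    obtain k where k: "i = Suc k" using assms(2) by (cases i) auto
    show "braid_at \<sigma> (n + i) (word us \<cdot> word ws) = word us \<cdot> braid_at \<sigma> i (word ws)"
      by (simp add: us k juxt_word braid_at_word[OF \<sigma>] nth_append juxt_simps
          juxt_assoc[symmetric])
  qed (intro clinear_compose[OF _ clinear_braid_at[OF \<sigma>]] clinear_juxt_left assms(1))+
qed (intro clinear_compose[OF _ clinear_braid_at[OF \<sigma>]] clinear_juxt_right'
    clinear_juxt_right clinear_braid_at[OF \<sigma>])+

lemma braid_at_tpow: "a \<in> tpow n \<Longrightarrow> braid_at \<sigma> i a \<in> tpow n"
proof (rule clinear_tpow_subset[OF clinear_braid_at[OF \<sigma>] subspace_tpow])
  fix vs :: "'v list" assume vs: "length vs = n"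
  show "braid_at \<sigma> i (word vs) \<in> tpow n"
  proof (cases "1 \<le> i \<and> i < n")
    case True
    have "word (take (i - 1) vs) \<cdot> pair_word (\<sigma> (vs ! (i - 1) \<otimes> vs ! i)) \<cdot> word (drop (i + 1) vs)
      \<in> tpow ((i - 1) + (2 + (n - (i + 1))))"
      using True vs by (intro juxt_tpow pair_word_in_tpow word_in_tpow) auto
    moreover have "(i - 1) + (2 + (n - (i + 1))) = n" using True by linarith
    ultimately show ?thesis using True vs by (simp add: braid_at_word[OF \<sigma>])
  next
    case False
    then show ?thesis
      using vs by (auto simp: braid_at_word[OF \<sigma>] intro: cvec.subspace_0[OF subspace_tpow])
  qed
qed

lemma braid_at_far:
  assumes "Suc i < j"
  shows "braid_at \<sigma> i (braid_at \<sigma> j x) = braid_at \<sigma> j (braid_at \<sigma> i x)"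
proof (rule clinear_eq_on_words[of "\<lambda>x. braid_at \<sigma> i (braid_at \<sigma> j x)" "\<lambda>x. braid_at \<sigma> j (braid_at \<sigma> i x)"])
  note lin0 = clinear_simps(3)[OF clinear_braid_at[OF \<sigma>]]
  fix vs :: "'v list"
  show "braid_at \<sigma> i (braid_at \<sigma> j (word vs)) = braid_at \<sigma> j (braid_at \<sigma> i (word vs))"
  proof (cases "length vs \<le> j")
    case True
    have "word vs \<in> tpow (length vs)" by (simp add: word_in_tpow)
    then show ?thesis
      using braid_at_eq_0[of j "length vs"] True braid_at_tpow by (simp add: lin0)
  next
    case False
    define k where "k = j - Suc i"
    have j: "j = Suc i + k" "1 \<le> k" using assms by (auto simp: k_def)
    \<comment> \<open>Cutting behind letter i + 1 leaves both letters moved by the i-th operator on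
      the left and both moved by the j-th on the right.\<close>
    let ?a = "word (take (Suc i) vs)" and ?b = "word (drop (Suc i) vs)"
    have a: "?a \<in> tpow (Suc i)" using False assms by (intro word_in_tpow) auto
    have "word vs = ?a \<cdot> ?b" by (simp add: juxt_word)
    then show ?thesis
      unfolding j(1)
      by (simp only: braid_at_juxt_right[OF _ j(2)] a braid_at_tpow[OF a]
          braid_at_juxt_left[OF a lessI])
  qed
qed (intro clinear_compose[OF clinear_braid_at[OF \<sigma>] clinear_braid_at[OF \<sigma>]])+

end

text \<open>The braid equation is assumed in degree 3; locality carries it to three consecutive
  letters of a longer word. Outside that range both sides vanish, so the relation holds for every
  index, as \<open>braid_relations\<close> demands.\<close>

lemma braid_at_near:
  fixes \<sigma> :: "('v::complex_vector, 'v) tensor \<Rightarrow> ('v, 'v) tensor"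
  assumes "braiding \<sigma>"
  shows "braid_at \<sigma> i (braid_at \<sigma> (Suc i) (braid_at \<sigma> i x)) =
    braid_at \<sigma> (Suc i) (braid_at \<sigma> i (braid_at \<sigma> (Suc i) x))"
proof -
  let ?s = "braid_at \<sigma>"
  have \<sigma>: "clinear \<sigma>" and yb: "\<And>x. x \<in> tpow 3 \<Longrightarrow> ?s 1 (?s 2 (?s 1 x)) = ?s 2 (?s 1 (?s 2 x))"
    using assms unfolding braiding_def by auto
  note lin = clinear_braid_at[OF \<sigma>]
  note lin0 = clinear_simps(3)[OF lin]
  show ?thesis
  proof (rule clinear_eq_on_words[of "\<lambda>x. ?s i (?s (Suc i) (?s i x))" "\<lambda>x. ?s (Suc i) (?s i (?s (Suc i) x))"])
    fix vs :: "'v list"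
    have vs: "word vs \<in> tpow (length vs)" by (simp add: word_in_tpow)
    consider "i = 0" | "length vs \<le> Suc i" | k where "i = k + 1" "i + 1 < length vs"
      by (cases i) (auto simp: not_le[symmetric])
    then show "?s i (?s (Suc i) (?s i (word vs))) = ?s (Suc i) (?s i (?s (Suc i) (word vs)))"
    proof cases
      case 1
      then show ?thesis by (simp add: braid_at_0[OF \<sigma>] lin0)
    next
      case 2
      then show ?thesis
        using vs by (simp add: braid_at_eq_0[OF \<sigma>, of "Suc i" "length vs"] braid_at_tpow[OF \<sigma>] lin0)
    next
      case 3
      let ?a = "word (take k vs)" and ?b = "word (take 3 (drop k vs))" and ?c = "word (drop (k + 3) vs)"
      have a: "?a \<in> tpow k" and b: "?b \<in> tpow 3" using 3 by (auto intro!: word_in_tpow)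
      have "word vs = ?a \<cdot> ?b \<cdot> ?c"
        by (simp add: juxt_word) (metis append_take_drop_id drop_drop add.commute)
      moreover have shift: "?s i (?a \<cdot> x \<cdot> ?c) = ?a \<cdot> ?s 1 x \<cdot> ?c"
        "?s (Suc i) (?a \<cdot> x \<cdot> ?c) = ?a \<cdot> ?s 2 x \<cdot> ?c" if "x \<in> tpow 3" for x
        using braid_at_juxt_right[OF \<sigma> a, of 1] braid_at_juxt_right[OF \<sigma> a, of 2] 3(1)
          braid_at_juxt_left[OF \<sigma> that] by simp_all
      ultimately show ?thesis
        using b by (simp add: shift braid_at_tpow[OF \<sigma>] yb[unfolded One_nat_def])
    qed
  qed (intro clinear_compose[OF clinear_compose[OF lin lin] lin])+
qed

lemma braid_relations_braid_at: "braiding \<sigma> \<Longrightarrow> braid_relations (braid_at \<sigma>)"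
  by unfold_locales (auto simp: fun_eq_iff braid_at_near braiding_def intro: braid_at_far)

section \<open>The operators of permutations\<close>

lemma T_op_eq_wordprod: "T_op \<sigma> p w = wordprod (braid_at \<sigma>) (SOME is. reduced_word p w is)"
  by (simp add: T_op_def wordprod_def)

context
  fixes \<sigma> :: "('v::complex_vector, 'v) tensor \<Rightarrow> ('v, 'v) tensor"
  assumes braiding: "braiding \<sigma>"
begin

lemma clinear_braiding: "clinear \<sigma>"
  using braiding by (simp add: braiding_def)

lemma clinear_wordprod: "clinear (wordprod (braid_at \<sigma>) is)"
proof (induction "is")
  case Nil
  then show ?case using clinear_id by (simp add: id_def)
next
  case (Cons i "is")
  then show ?case
    using clinear_compose[OF Cons clinear_braid_at[OF clinear_braiding]] by (simp add: comp_def)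
qed

lemma wordprod_tpow: "a \<in> tpow n \<Longrightarrow> wordprod (braid_at \<sigma>) is a \<in> tpow n"
  by (induction "is") (simp_all add: braid_at_tpow[OF clinear_braiding])

lemma wordprod_juxt_left:
  assumes "a \<in> tpow n" "set is \<subseteq> {1..<n}"
  shows "wordprod (braid_at \<sigma>) is (a \<cdot> b) = wordprod (braid_at \<sigma>) is a \<cdot> b"
  using assms(2)
  by (induction "is")
    (simp_all add: braid_at_juxt_left[OF clinear_braiding wordprod_tpow[OF assms(1)]])

lemma wordprod_juxt_right:
  assumes "a \<in> tpow n" "set is \<subseteq> {1..<p}"
  shows "wordprod (braid_at \<sigma>) (map ((+) n) is) (a \<cdot> b) = a \<cdot> wordprod (braid_at \<sigma>) is b"
  using assms(2)
  by (induction "is") (simp_all add: braid_at_juxt_right[OF clinear_braiding assms(1)])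

lemma clinear_T_op: "clinear (T_op \<sigma> p w)"
  unfolding T_op_eq_wordprod by (rule clinear_wordprod)

lemma T_op_tpow: "a \<in> tpow n \<Longrightarrow> T_op \<sigma> p w a \<in> tpow n"
  unfolding T_op_eq_wordprod by (rule wordprod_tpow)

text \<open>Frees \<open>T_op\<close> from the word picked by \<open>SOME\<close>.\<close>

lemma T_op_reduced_word:
  assumes "reduced_word p w is"
  shows "T_op \<sigma> p w = wordprod (braid_at \<sigma>) is"
proof -
  interpret braid_relations "braid_at \<sigma>"
    using braiding by (rule braid_relations_braid_at)
  show ?thesis
    unfolding T_op_eq_wordprod by (rule wordprod_unique[OF someI[of "reduced_word p w", OF assms] assms])
qed

text \<open>When lengths add, the concatenation of two reduced words is reduced.\<close>

lemma T_op_comp: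
  assumes w: "w permutes {1..p}" and y: "y permutes {1..p}"
    and card: "card (inversions (w \<circ> y)) = card (inversions w) + card (inversions y)"
  shows "T_op \<sigma> p (w \<circ> y) x = T_op \<sigma> p w (T_op \<sigma> p y x)"
proof -
  obtain us where us: "reduced_word p w us" using exists_reduced_word[OF w] ..
  obtain vs where vs: "reduced_word p y vs" using exists_reduced_word[OF y] ..
  have "reduced_word p (w \<circ> y) (us @ vs)"
    using us vs card by (simp add: reduced_word_iff perm_of_word_append)
  then show ?thesis
    by (simp add: T_op_reduced_word[OF us] T_op_reduced_word[OF vs] T_op_reduced_word wordprod_append)
qed

lemma T_op_id: "T_op \<sigma> p id = id"
proof -
  have "reduced_word p id []" by (simp add: reduced_word_iff)
  from T_op_reduced_word[OF this] show ?thesis by simp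
qed

text \<open>A reduced word of \<open>u\<close> acts before the cut and the shifted word of
  \<open>v\<close> behind it.\<close>

lemma T_op_block:
  assumes u: "u permutes {1..i}" and v: "v permutes {1..j}" and a: "a \<in> tpow i"
  shows "T_op \<sigma> (i + j) (u \<circ> shift_perm i v) (a \<cdot> b) = T_op \<sigma> i u a \<cdot> T_op \<sigma> j v b"
proof -
  obtain us where us: "reduced_word i u us" using exists_reduced_word[OF u] ..
  obtain vs where vs: "reduced_word j v vs" using exists_reduced_word[OF v] ..
  have us': "reduced_word (i + j) u us" using us by (rule reduced_word_mono) simp
  have vs': "reduced_word (i + j) (shift_perm i v) (map ((+) i) vs)"
    using vs by (rule reduced_word_shift)
  have sub: "set us \<subseteq> {1..<i}" "set vs \<subseteq> {1..<j}"
    using us vs by (auto simp: reduced_word_def)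
  have "T_op \<sigma> (i + j) (u \<circ> shift_perm i v) (a \<cdot> b) =
      T_op \<sigma> (i + j) u (T_op \<sigma> (i + j) (shift_perm i v) (a \<cdot> b))"
    by (rule T_op_comp[OF reduced_word_permutes[OF us'] reduced_word_permutes[OF vs']
      card_inversions_comp_shift[OF u v]])
  also have "\<dots> = wordprod (braid_at \<sigma>) us a \<cdot> wordprod (braid_at \<sigma>) vs b"
    unfolding T_op_reduced_word[OF us'] T_op_reduced_word[OF vs']
    by (simp only: wordprod_juxt_right[OF a sub(2)] wordprod_juxt_left[OF a sub(1)])
  finally show ?thesis
    by (simp add: T_op_reduced_word[OF us] T_op_reduced_word[OF vs])
qed

lemma clinear_A_op: "clinear (A_op \<sigma> p)"
  unfolding A_op_def[abs_def] by (intro clinear_sum_fun clinear_T_op)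

text \<open>Makes the block sum of both factorizations visible as A^(i) \<otimes> A^(j), which
  relates it to the spaces \<open>S_pow\<close>.\<close>

lemma sum_block_perms_juxt:
  assumes a: "a \<in> tpow i"
  shows "(\<Sum>y\<in>block_perms i j. T_op \<sigma> (i + j) y (a \<cdot> b)) = A_op \<sigma> i a \<cdot> A_op \<sigma> j b"
proof -
  have "(\<Sum>y\<in>block_perms i j. T_op \<sigma> (i + j) y (a \<cdot> b)) =
      (\<Sum>(u, v)\<in>{u. u permutes {1..i}} \<times> {v. v permutes {1..j}}.
        T_op \<sigma> (i + j) (u \<circ> shift_perm i v) (a \<cdot> b))"
    by (subst sum.reindex_bij_betw[OF bij_betw_block_perms, symmetric]) (simp add: case_prod_beta)
  also have "\<dots> = (\<Sum>(u, v)\<in>{u. u permutes {1..i}} \<times> {v. v permutes {1..j}}.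
        T_op \<sigma> i u a \<cdot> T_op \<sigma> j v b)"
    by (intro sum.cong refl) (auto simp: T_op_block[OF _ _ a, simplified])
  also have "\<dots> = A_op \<sigma> i a \<cdot> A_op \<sigma> j b"
    unfolding A_op_def juxt_simps sum.cartesian_product[symmetric] by (rule sum.swap)
  finally show ?thesis .
qed

text \<open>Each permutation is uniquely \<open>w \<circ> y\<close> and uniquely \<open>y \<circ> inv w\<close>, with \<open>w\<close> a shuffle and \<open>y\<close>
  preserving the two blocks, and both factorizations have additive length.\<close>

lemma A_op_shuffle:
  "A_op \<sigma> (i + j) x = (\<Sum>w\<in>shuffles_perm i j. T_op \<sigma> (i + j) w (\<Sum>y\<in>block_perms i j. T_op \<sigma> (i + j) y x))"
proof -
  have "A_op \<sigma> (i + j) x = (\<Sum>(w, y)\<in>shuffles_perm i j \<times> block_perms i j. T_op \<sigma> (i + j) (w \<circ> y) x)"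
    unfolding A_op_def
    by (subst sum.reindex_bij_betw[OF bij_betw_shuffle_block, symmetric]) (simp add: case_prod_beta)
  also have "\<dots> = (\<Sum>(w, y)\<in>shuffles_perm i j \<times> block_perms i j. T_op \<sigma> (i + j) w (T_op \<sigma> (i + j) y x))"
  proof (rule sum.cong[OF refl], clarify)
    fix w y assume wy: "w \<in> shuffles_perm i j" "y \<in> block_perms i j"
    then have "w permutes {1..i + j}" "y permutes {1..i + j}"
      unfolding shuffles_perm_def block_perms_def by simp_all
    then show "T_op \<sigma> (i + j) (w \<circ> y) x = T_op \<sigma> (i + j) w (T_op \<sigma> (i + j) y x)"
      by (rule T_op_comp[OF _ _ card_inversions_shuffle_block[OF wy]])
  qed
  finally show ?thesis
    by (simp only: sum.cartesian_product clinear_simps(4)[OF clinear_T_op])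
qed

text \<open>Inversion turns \<open>w \<circ> inv y\<close> into \<open>y \<circ> inv w\<close>, so
  the coset decomposition can be carried over instead of being proved again.\<close>

lemma bij_betw_block_inv_shuffle:
  "bij_betw (\<lambda>(w, y). y \<circ> inv w) (shuffles_perm i j \<times> block_perms i j) {x. x permutes {1..i + j}}"
proof -
  let ?P = "{x. x permutes {1..i + j}}"
  have "bij_betw inv (block_perms i j) (block_perms i j)"
    by (rule bij_betwI[where g = inv])
      (auto simp: block_perms_inv, auto simp: block_perms_def permutes_inv_inv)
  then have "bij_betw (map_prod id inv) (shuffles_perm i j \<times> block_perms i j) (shuffles_perm i j \<times> block_perms i j)"
    by (intro bij_betw_map_prod) simp_all
  moreover have "bij_betw inv ?P ?P"
    by (rule bij_betwI[where g = inv]) (auto simp: permutes_inv permutes_inv_inv)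
  ultimately have "bij_betw (inv \<circ> (\<lambda>(w, y). w \<circ> y) \<circ> map_prod id inv) (shuffles_perm i j \<times> block_perms i j) ?P"
    by (intro bij_betw_trans[OF _ bij_betw_trans[OF bij_betw_shuffle_block]])
  moreover have "(inv \<circ> (\<lambda>(w, y). w \<circ> y) \<circ> map_prod id inv) z = (\<lambda>(w, y). y \<circ> inv w) z"
    if z: "z \<in> shuffles_perm i j \<times> block_perms i j" for z
  proof -
    obtain w y where z_eq: "z = (w, y)" by (cases z)
    have "w permutes {1..i + j}" and y: "y permutes {1..i + j}"
      using z unfolding z_eq shuffles_perm_def block_perms_def by simp_all
    then have "bij w" "bij (inv y)" by (auto intro: permutes_bij permutes_inv)
    then show ?thesis by (simp add: z_eq o_inv_distrib permutes_inv_inv[OF y])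
  qed
  ultimately show ?thesis
    by (subst bij_betw_cong[symmetric]) auto
qed

text \<open>Here the block permutations act last, which confines the image of \<open>A_op\<close> to
  that of the block sum.\<close>

lemma A_op_unshuffle:
  "A_op \<sigma> (i + j) x = (\<Sum>y\<in>block_perms i j. T_op \<sigma> (i + j) y (\<Sum>w\<in>shuffles_perm i j. T_op \<sigma> (i + j) (inv w) x))"
proof -
  have "A_op \<sigma> (i + j) x = (\<Sum>(w, y)\<in>shuffles_perm i j \<times> block_perms i j. T_op \<sigma> (i + j) (y \<circ> inv w) x)"
    unfolding A_op_def
    by (subst sum.reindex_bij_betw[OF bij_betw_block_inv_shuffle, symmetric]) (simp add: case_prod_beta)
  also have "\<dots> = (\<Sum>(w, y)\<in>shuffles_perm i j \<times> block_perms i j. T_op \<sigma> (i + j) y (T_op \<sigma> (i + j) (inv w) x))"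
  proof (rule sum.cong[OF refl], clarify)
    fix w y assume wy: "w \<in> shuffles_perm i j" "y \<in> block_perms i j"
    then have w: "w permutes {1..i + j}" and y: "y permutes {1..i + j}"
      unfolding shuffles_perm_def block_perms_def by simp_all
    show "T_op \<sigma> (i + j) (y \<circ> inv w) x = T_op \<sigma> (i + j) y (T_op \<sigma> (i + j) (inv w) x)"
      by (rule T_op_comp[OF y permutes_inv[OF w] card_inversions_block_inv_shuffle[OF wy]])
  qed
  also have "\<dots> = (\<Sum>w\<in>shuffles_perm i j. \<Sum>y\<in>block_perms i j. T_op \<sigma> (i + j) y (T_op \<sigma> (i + j) (inv w) x))"
    by (simp only: sum.cartesian_product)
  also have "\<dots> = (\<Sum>y\<in>block_perms i j. \<Sum>w\<in>shuffles_perm i j. T_op \<sigma> (i + j) y (T_op \<sigma> (i + j) (inv w) x))"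
    by (rule sum.swap)
  finally show ?thesis
    by (simp only: clinear_simps(4)[OF clinear_T_op])
qed

section \<open>The symmetric powers\<close>

lemma subspace_S_pow: "cvec.subspace (S_pow \<sigma> p)"
  unfolding S_pow_def by (rule clinear_image_subspace[OF clinear_A_op subspace_tpow])

lemma S_pow_subset_tpow: "x \<in> S_pow \<sigma> p \<Longrightarrow> x \<in> tpow p"
  unfolding S_pow_def A_op_def by (auto intro!: cvec.subspace_sum[OF subspace_tpow] T_op_tpow)

text \<open>In degree 0 the only permutation is the identity; the empty word serves as right factor
  in \<open>conv2_unit_right\<close>.\<close>

lemma word_Nil_in_S_pow: "word [] \<in> S_pow \<sigma> 0"
proof -
  have "A_op \<sigma> 0 (word []) = word []"
    by (simp add: A_op_def T_op_id)
  then show ?thesis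
    unfolding S_pow_def by (metis imageI list.size(3) word_in_tpow)
qed

lemma clinear_sh: "clinear (sh \<sigma> i j)"
  unfolding sh_def[abs_def]
  by (intro clinear_sum_fun clinear_compose[OF clinear_juxtapose clinear_T_op])

lemma sh_tens_A_op:
  assumes "a \<in> tpow i"
  shows "sh \<sigma> i j (A_op \<sigma> i a \<otimes> A_op \<sigma> j b) = A_op \<sigma> (i + j) (a \<cdot> b)"
  by (simp only: sh_def A_op_shuffle sum_block_perms_juxt[OF assms] juxt_def[symmetric])

lemma sh_in_S_pow:
  assumes "t \<in> tensor_space (S_pow \<sigma> i) (S_pow \<sigma> j)"
  shows "sh \<sigma> i j t \<in> S_pow \<sigma> (i + j)"
proof (rule clinear_image_span_subset[OF clinear_sh subspace_S_pow _ assms[unfolded tensor_space_def]])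
  fix s assume "s \<in> {u \<otimes> w |u w. u \<in> S_pow \<sigma> i \<and> w \<in> S_pow \<sigma> j}"
  then obtain a b where "a \<in> tpow i" "b \<in> tpow j" "s = A_op \<sigma> i a \<otimes> A_op \<sigma> j b"
    unfolding S_pow_def by blast
  then show "sh \<sigma> i j s \<in> S_pow \<sigma> (i + j)"
    by (simp add: sh_tens_A_op S_pow_def juxt_tpow)
qed

lemma deconc_in_tensor_space:
  assumes "x \<in> S_pow \<sigma> (i + j)"
  shows "deconc i j x \<in> tensor_space (S_pow \<sigma> i) (S_pow \<sigma> j)"
proof -
  let ?B = "\<lambda>z. \<Sum>y\<in>block_perms i j. T_op \<sigma> (i + j) y z"
  have lin: "clinear (\<lambda>z. deconc i j (?B z))"
    by (intro clinear_compose[OF _ clinear_deconc] clinear_sum_fun clinear_T_op)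
  obtain z where z: "z \<in> tpow (i + j)" "x = A_op \<sigma> (i + j) z"
    using assms by (auto simp: S_pow_def)
  \<comment> \<open>The argument of the block sum in \<open>A_op_unshuffle\<close>; it is again of
    degree i + j, hence a combination of words that can be cut.\<close>
  define z' where "z' = (\<Sum>w\<in>shuffles_perm i j. T_op \<sigma> (i + j) (inv w) z)"
  have z': "z' \<in> tpow (i + j)"
    unfolding z'_def by (intro cvec.subspace_sum[OF subspace_tpow] T_op_tpow z)
  have "x = ?B z'" by (simp only: z(2) A_op_unshuffle z'_def)
  moreover have "deconc i j (?B z') \<in> tensor_space (S_pow \<sigma> i) (S_pow \<sigma> j)"
    unfolding tensor_space_def
  proof (rule clinear_tpow_subset[OF lin cvec.subspace_span _ z'])
    fix vs :: "'v list" assume vs: "length vs = i + j"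
    let ?a = "word (take i vs)" and ?b = "word (drop i vs)"
    have ab: "?a \<in> tpow i" "?b \<in> tpow j" using vs by (auto intro: word_in_tpow)
    have S: "A_op \<sigma> i ?a \<in> S_pow \<sigma> i" "A_op \<sigma> j ?b \<in> S_pow \<sigma> j"
      using ab by (auto simp: S_pow_def)
    have "word vs = ?a \<cdot> ?b" by (simp add: juxt_word)
    then have "deconc i j (?B (word vs)) = A_op \<sigma> i ?a \<otimes> A_op \<sigma> j ?b"
      using deconc_juxt[OF S_pow_subset_tpow[OF S(1)] S_pow_subset_tpow[OF S(2)]]
      by (simp only: sum_block_perms_juxt[OF ab(1)])
    then show "deconc i j (?B (word vs)) \<in> cvec.span {u \<otimes> w |u w. u \<in> S_pow \<sigma> i \<and> w \<in> S_pow \<sigma> j}"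
      using S by (auto intro: cvec.span_base)
  qed
  ultimately show ?thesis by (simp only:)
qed

end

section \<open>Linear maps between subspaces\<close>

lemma Hom_add:
  assumes "f \<in> Hom U W" "g \<in> Hom U W" "cvec.subspace W"
  shows "(\<lambda>x. f x + g x) \<in> Hom U W"
  using assms
  by (auto simp: Hom_def clinear_on_def scaleC_add_right cvec.subspace_add algebra_simps
      image_subset_iff)

lemma Hom_scale:
  assumes "f \<in> Hom U W" "cvec.subspace W"
  shows "(\<lambda>x. c *\<^sub>C f x) \<in> Hom U W"
  using assms
  by (auto simp: Hom_def clinear_on_def scaleC_add_right scaleC_scaleC cvec.subspace_scale mult.commute
      image_subset_iff)

lemma Hom_zero: "cvec.subspace W \<Longrightarrow> (\<lambda>x. 0) \<in> Hom U W"
  by (auto simp: Hom_def clinear_on_def cvec.subspace_0)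

lemma Hom_sum:
  assumes "\<And>a. a \<in> A \<Longrightarrow> f a \<in> Hom U W" "cvec.subspace W"
  shows "(\<lambda>x. \<Sum>a\<in>A. f a x) \<in> Hom U W"
  using assms by (induction A rule: infinite_finite_induct) (auto simp: Hom_zero intro: Hom_add)

lemma Hom_diff:
  assumes "f \<in> Hom U W" "g \<in> Hom U W" "cvec.subspace W"
  shows "(\<lambda>x. f x - g x) \<in> Hom U W"
  using Hom_add[OF assms(1) Hom_scale[OF assms(2,3), of "-1"] assms(3)] by simp

lemma Hom_restrict0:
  assumes "clinear_on U f" "\<And>x. x \<in> U \<Longrightarrow> f x \<in> W" "cvec.subspace U"
  shows "restrict0 U f \<in> Hom U W"
  using assms
  by (auto simp: Hom_def clinear_on_def restrict0_def cvec.subspace_add cvec.subspace_scale)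

lemma Id_on_space_End: "cvec.subspace U \<Longrightarrow> Id_on_space U \<in> End U"
  by (rule Hom_restrict0) (auto simp: clinear_on_def)

lemma Hom_simps:
  assumes "f \<in> Hom U W"
  shows "x \<in> U \<Longrightarrow> y \<in> U \<Longrightarrow> f (x + y) = f x + f y" "x \<in> U \<Longrightarrow> f (c *\<^sub>C x) = c *\<^sub>C f x"
    "x \<in> U \<Longrightarrow> f x \<in> W" "x \<notin> U \<Longrightarrow> f x = 0"
  using assms by (auto simp: Hom_def clinear_on_def)

lemma Hom_0: "f \<in> Hom U W \<Longrightarrow> cvec.subspace U \<Longrightarrow> f 0 = 0"
  using Hom_simps(2)[of f U W 0 0] cvec.subspace_0[of U] by simp

lemma End_comp:
  assumes "f \<in> End U" "g \<in> End U" "cvec.subspace U"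
  shows "f \<circ> g \<in> End U"
  unfolding Hom_def clinear_on_def
  using Hom_simps[OF assms(1)] Hom_simps[OF assms(2)] Hom_0[OF assms(1,3)]
  by (simp add: image_subset_iff)

lemma Hom_eq_on_span:
  assumes f: "f \<in> Hom U W" and g: "g \<in> Hom U W" and U: "U = cvec.span B"
    and eq: "\<And>b. b \<in> B \<Longrightarrow> f b = g b"
  shows "f = g"
proof
  fix x
  show "f x = g x"
  proof (cases "x \<in> U")
    case True
    then have "x \<in> cvec.span B" by (simp add: U)
    \<comment> \<open>Additivity holds on \<open>U\<close> only, so membership in \<open>U\<close>
      is carried through the induction.\<close>
    then have "x \<in> U \<and> f x = g x"
    proof (induction rule: cvec.span_induct_alt)
      case base
      show ?case by (simp add: Hom_0[OF f] Hom_0[OF g] U cvec.span_zero)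
    next
      case (step c b y)
      have "c *\<^sub>C b + y \<in> U" "b \<in> U" "c *\<^sub>C b \<in> U"
        using step by (simp_all add: U cvec.span_base cvec.span_scale cvec.span_add)
      then show ?case
        using step by (simp add: Hom_simps(1,2)[OF f] Hom_simps(1,2)[OF g] eq)
    qed
    then show ?thesis ..
  qed (simp add: Hom_simps[OF f] Hom_simps[OF g])
qed

text \<open>\<open>tensor_lift\<close> needs maps linear on the whole space, whereas
  \<open>f\<close> is cut off outside \<open>U\<close>; a basis of \<open>U\<close> yields a linear
  map agreeing with \<open>f\<close> there.\<close>

lemma Hom_extension:
  assumes f: "f \<in> Hom U W" and U: "cvec.subspace U"
  obtains F where "clinear F" "\<And>x. x \<in> U \<Longrightarrow> F x = f x"
proof -
  obtain B where B: "B \<subseteq> U" "\<not> cvec.dependent B" "U \<subseteq> cvec.span B"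
    using cvec.maximal_independent_subset by blast
  obtain F where F: "clinear F" "\<forall>x\<in>B. F x = f x"
    using cpair.linear_independent_extend[OF B(2)] by blast
  have UB: "U = cvec.span B"
    using B U by (simp add: cvec.span_minimal subset_antisym)
  have "clinear_on U F" by (simp add: clinear_on_def clinear_simps[OF F(1)])
  then have "restrict0 U F \<in> Hom U UNIV" using U by (intro Hom_restrict0) auto
  moreover have "f \<in> Hom U UNIV" using f by (auto simp: Hom_def)
  ultimately have "restrict0 U F = f"
    using F(2) B(1) by (intro Hom_eq_on_span[OF _ _ UB]) (auto simp: restrict0_def)
  then have "F x = f x" if "x \<in> U" for x
    using that by (auto simp: restrict0_def fun_eq_iff split: if_splits)
  with F(1) show thesis by (rule that)
qed

lemma tensor_map_unique:
  assumes "h \<in> End (tensor_space U W)" "h' \<in> End (tensor_space U W)"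
    and "\<And>u w. u \<in> U \<Longrightarrow> w \<in> W \<Longrightarrow> h (u \<otimes> w) = h' (u \<otimes> w)"
  shows "h = h'"
  by (rule Hom_eq_on_span[OF assms(1,2) tensor_space_def]) (use assms(3) in auto)

text \<open>Shows that the \<open>THE\<close> in \<open>tensor_map\<close> denotes: existence by
  lifting linear extensions and cutting off, uniqueness because pure tensors span.\<close>

lemma
  assumes f: "f \<in> End U" and g: "g \<in> End W" and U: "cvec.subspace U" and W: "cvec.subspace W"
  shows tensor_map_End: "tensor_map U W f g \<in> End (tensor_space U W)" (is ?th1)
    and tensor_map_tens: "u \<in> U \<Longrightarrow> w \<in> W \<Longrightarrow> tensor_map U W f g (u \<otimes> w) = f u \<otimes> g w"
      (is "_ \<Longrightarrow> _ \<Longrightarrow> ?th2")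
proof -
  obtain F where F: "clinear F" "\<And>x. x \<in> U \<Longrightarrow> F x = f x" by (rule Hom_extension[OF f U]) blast
  obtain G where G: "clinear G" "\<And>x. x \<in> W \<Longrightarrow> G x = g x" by (rule Hom_extension[OF g W]) blast
  let ?T = "tensor_space U W"
  define H where "H = tensor_lift (\<lambda>x y. F x \<otimes> G y)"
  have lin: "clinear (\<lambda>x. F x \<otimes> G y)" "clinear (\<lambda>y. F x \<otimes> G y)" for x y
    by (rule clinear_compose[OF F(1) clinear_tens_left], rule clinear_compose[OF G(1) clinear_tens_right])
  have H: "clinear H" "\<And>x y. H (x \<otimes> y) = F x \<otimes> G y"
    unfolding H_def using tensor_lift[OF lin] by auto
  have T: "cvec.subspace ?T" by (simp add: tensor_space_def)
  have tens: "u \<otimes> w \<in> ?T" if "u \<in> U" "w \<in> W" for u w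
    unfolding tensor_space_def using that by (intro cvec.span_base) blast
  have "H t \<in> ?T" if "t \<in> ?T" for t
    by (rule clinear_image_span_subset[OF H(1) T _ that[unfolded tensor_space_def]])
      (use Hom_simps(3)[OF f] Hom_simps(3)[OF g] in \<open>auto simp: H F G tens\<close>)
  then have "restrict0 ?T H \<in> End ?T"
    using T by (intro Hom_restrict0) (auto simp: clinear_on_def clinear_simps[OF H(1)])
  moreover have "\<forall>u\<in>U. \<forall>w\<in>W. restrict0 ?T H (u \<otimes> w) = f u \<otimes> g w"
    by (simp add: restrict0_def tens H F G)
  ultimately have "\<exists>!h. h \<in> End ?T \<and> (\<forall>u\<in>U. \<forall>w\<in>W. h (u \<otimes> w) = f u \<otimes> g w)"
    by (intro ex1I[of _ "restrict0 ?T H"]) (auto intro: tensor_map_unique)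
  from theI'[OF this]
  show ?th1 and "u \<in> U \<Longrightarrow> w \<in> W \<Longrightarrow> ?th2"
    unfolding tensor_map_def by auto
qed

lemma tensor_map_add_left:
  assumes f: "f \<in> End U" and f': "f' \<in> End U" and g: "g \<in> End W"
    and U: "cvec.subspace U" and W: "cvec.subspace W"
  shows "tensor_map U W (\<lambda>x. f x + f' x) g = (\<lambda>t. tensor_map U W f g t + tensor_map U W f' g t)"
proof (rule tensor_map_unique)
  have ff: "(\<lambda>x. f x + f' x) \<in> End U" by (rule Hom_add[OF f f' U])
  show "tensor_map U W (\<lambda>x. f x + f' x) g \<in> End (tensor_space U W)"
    by (rule tensor_map_End[OF ff g U W])
  show "(\<lambda>t. tensor_map U W f g t + tensor_map U W f' g t) \<in> End (tensor_space U W)"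
    by (intro Hom_add tensor_map_End f f' g U W) (simp add: tensor_space_def)
  show "tensor_map U W (\<lambda>x. f x + f' x) g (u \<otimes> w) = tensor_map U W f g (u \<otimes> w) + tensor_map U W f' g (u \<otimes> w)"
    if "u \<in> U" "w \<in> W" for u w
    using that by (simp add: tensor_map_tens f f' ff g U W tens_add_left)
qed

text \<open>The image of a spanning vector gives the scalar, and its being nonzero gives uniqueness;
  this makes \<open>q_trace\<close> well defined.\<close>

lemma End_one_dim:
  assumes "has_dim U 1" "f \<in> End U"
  shows "\<exists>!c. f = (\<lambda>x. c *\<^sub>C Id_on_space U x)"
proof -
  obtain b where b: "b \<noteq> 0" and U: "U = cvec.span {b}"
    using assms(1) unfolding has_dim_def by (auto simp: card_1_singleton_iff)
  have bU: "b \<in> U" by (simp add: U cvec.span_base)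
  then obtain c where c: "f b = c *\<^sub>C b"
    using Hom_simps(3)[OF assms(2), of b] unfolding U by (auto simp: cvec.span_singleton)
  show ?thesis
  proof (rule ex1I[of _ c])
    show "f = (\<lambda>x. c *\<^sub>C Id_on_space U x)"
      by (rule Hom_eq_on_span[OF assms(2) Hom_scale[OF Id_on_space_End] U])
        (simp_all add: U[symmetric] c restrict0_def bU, simp_all add: U)
  next
    fix d assume "f = (\<lambda>x. d *\<^sub>C Id_on_space U x)"
    then have "d *\<^sub>C b = c *\<^sub>C b" using c bU by (metis restrict0_def)
    then show "d = c" using b by simp
  qed
qed

context
  fixes \<sigma> :: "('v::complex_vector, 'v) tensor \<Rightarrow> ('v, 'v) tensor"
  assumes braiding: "braiding \<sigma>"
begin

section \<open>The convolution product\<close>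

text \<open>\<open>tensor_map\<close> is linear on the tensor space of its two domains, so linearity
  of the composite rests on deconcatenation landing there.\<close>

lemma conv2_End:
  assumes "f \<in> End (S_pow \<sigma> i)" "g \<in> End (S_pow \<sigma> j)"
  shows "conv2 \<sigma> i j f g \<in> End (S_pow \<sigma> (i + j))"
proof -
  let ?t = "tensor_map (S_pow \<sigma> i) (S_pow \<sigma> j) f g"
  note t = tensor_map_End[OF assms subspace_S_pow[OF braiding] subspace_S_pow[OF braiding]]
  note d = deconc_in_tensor_space[OF braiding]
  show ?thesis
    unfolding conv2_def
  proof (rule Hom_restrict0[OF _ _ subspace_S_pow[OF braiding]])
    show "clinear_on (S_pow \<sigma> (i + j)) (sh \<sigma> i j \<circ> ?t \<circ> deconc i j)"
      unfolding clinear_on_def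
      by (simp add: clinear_simps[OF clinear_deconc] clinear_simps[OF clinear_sh[OF braiding]]
          Hom_simps(1,2)[OF t] d)
    show "(sh \<sigma> i j \<circ> ?t \<circ> deconc i j) x \<in> S_pow \<sigma> (i + j)" if "x \<in> S_pow \<sigma> (i + j)" for x
      by (simp add: sh_in_S_pow[OF braiding] Hom_simps(3)[OF t] d that)
  qed
qed

lemma conv2_add_left:
  assumes "f \<in> End (S_pow \<sigma> i)" "f' \<in> End (S_pow \<sigma> i)" "g \<in> End (S_pow \<sigma> j)"
  shows "conv2 \<sigma> i j (\<lambda>x. f x + f' x) g x = conv2 \<sigma> i j f g x + conv2 \<sigma> i j f' g x"
  unfolding conv2_def tensor_map_add_left[OF assms subspace_S_pow[OF braiding] subspace_S_pow[OF braiding]]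
  by (simp add: restrict0_def clinear_simps[OF clinear_sh[OF braiding]])

lemma shuffles_perm_0_right: "shuffles_perm i 0 = {id}"
proof
  show "shuffles_perm i 0 \<subseteq> {id}"
  proof
    fix w assume w: "w \<in> shuffles_perm i 0"
    have wp: "w permutes {1..i}" using w by (simp add: shuffles_perm_def)
    have "w a < w b" if "a < b" for a b
    proof (cases "b \<le> i")
      case True
      then show ?thesis using shuffles_perm_less[OF w that] that by simp
    next
      case False
      then have "w b = b" using permutes_not_in[OF wp, of b] by simp
      moreover have "w a < b"
        using permutes_not_in[OF wp, of a] permutes_in_image[OF wp, of a] that False
        by (cases "a \<in> {1..i}") auto
      ultimately show ?thesis by simp
    qed
    then have "inversions w = {}" by (fastforce simp: inversions_def)
    then show "w \<in> {id}" using permutes_eq_id_if_no_inversions[OF wp] by simp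
  qed
qed (simp add: shuffles_perm_def strict_mono_on_def)

lemma conv2_unit_right:
  assumes f: "f \<in> End (S_pow \<sigma> p)"
  shows "conv2 \<sigma> p 0 f (Id_on_space (S_pow \<sigma> 0)) = f"
proof
  note sub = subspace_S_pow[OF braiding]
  note nil = word_Nil_in_S_pow[OF braiding]
  fix x
  show "conv2 \<sigma> p 0 f (Id_on_space (S_pow \<sigma> 0)) x = f x"
  proof (cases "x \<in> S_pow \<sigma> p")
    case True
    \<comment> \<open>The cut behind the last letter leaves the empty word on the right.\<close>
    have "deconc p 0 x = x \<otimes> word []"
      using deconc_juxt[OF S_pow_subset_tpow[OF braiding True] word_in_tpow[of "[]" 0]]
      by (simp add: juxt_word_Nil)
    then show ?thesis
      using True
      by (simp add: conv2_def restrict0_def[of "S_pow \<sigma> p"] tensor_map_tens[OF f Id_on_space_End[OF sub] sub sub True nil]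
          sh_def shuffles_perm_0_right T_op_id[OF braiding] juxt_def[symmetric])
        (simp add: restrict0_def nil juxt_word_Nil)
  qed (simp add: conv2_def restrict0_def Hom_simps(4)[OF f])
qed

lemma q_exp_End: "q_exp \<sigma> M \<in> End_sum \<sigma> M"
  by (simp add: End_sum_def q_exp_def Id_on_space_End[OF subspace_S_pow[OF braiding]])

lemma conv2_q_exp_End:
  assumes "f \<in> End (S_pow \<sigma> l)" "l \<le> p" "p \<le> M"
  shows "conv2 \<sigma> l (p - l) f (q_exp \<sigma> M (p - l)) \<in> End (S_pow \<sigma> p)"
proof -
  have "q_exp \<sigma> M (p - l) \<in> End (S_pow \<sigma> (p - l))"
    using q_exp_End[of M] assms(2,3) by (simp add: End_sum_def)
  from conv2_End[OF assms(1) this] show ?thesis using assms(2) by simp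
qed

lemma alpha_End_sum:
  assumes "A \<in> End_sum \<sigma> M"
  shows "alpha \<sigma> M A \<in> End_sum \<sigma> M"
proof -
  have A: "A l \<in> End (S_pow \<sigma> l)" if "l \<le> M" for l
    using assms that by (simp add: End_sum_def)
  show ?thesis
    unfolding End_sum_def alpha_def fam_conv_def
    by (auto intro!: Hom_sum conv2_q_exp_End A subspace_S_pow[OF braiding])
qed

lemma alpha_fam_add:
  assumes "A \<in> End_sum \<sigma> M" "B \<in> End_sum \<sigma> M"
  shows "alpha \<sigma> M (fam_add A B) = fam_add (alpha \<sigma> M A) (alpha \<sigma> M B)"
proof (intro ext)
  fix p x
  have q: "q_exp \<sigma> M (p - l) \<in> End (S_pow \<sigma> (p - l))" if "p \<le> M" for l
    using q_exp_End[of M] that by (simp add: End_sum_def)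
  have "conv2 \<sigma> l (p - l) (\<lambda>x. A l x + B l x) (q_exp \<sigma> M (p - l)) x =
      conv2 \<sigma> l (p - l) (A l) (q_exp \<sigma> M (p - l)) x + conv2 \<sigma> l (p - l) (B l) (q_exp \<sigma> M (p - l)) x"
    if "l \<le> p" "p \<le> M" for l
    using assms that by (intro conv2_add_left q) (auto simp: End_sum_def)
  then show "alpha \<sigma> M (fam_add A B) p x = fam_add (alpha \<sigma> M A) (alpha \<sigma> M B) p x"
    by (simp add: alpha_def fam_conv_def fam_add_def sum.distrib)
qed

text \<open>The summand l = p is convolution with the identity of degree 0 and gives the diagonal
  term unchanged.\<close>

lemma alpha_triangular:
  assumes "A \<in> End_sum \<sigma> M" "p \<le> M"
  shows "alpha \<sigma> M A p x =
    (\<Sum>l<p. conv2 \<sigma> l (p - l) (A l) (q_exp \<sigma> M (p - l)) x) + A p x"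
proof -
  have "conv2 \<sigma> p 0 (A p) (q_exp \<sigma> M 0) x = A p x"
    using conv2_unit_right[of "A p" p] assms by (simp add: q_exp_def End_sum_def)
  then show ?thesis
    using assms(2) by (simp add: alpha_def fam_conv_def lessThan_Suc_atMost[symmetric])
qed

end

section \<open>Surjectivity of alpha\<close>

fun alpha_preimage :: "(('v::complex_vector, 'v) tensor \<Rightarrow> ('v, 'v) tensor) \<Rightarrow> nat \<Rightarrow>
    'v family \<Rightarrow> 'v family"
  where "alpha_preimage \<sigma> M B p = (\<lambda>x. B p x -
    (\<Sum>l<p. conv2 \<sigma> l (p - l) (alpha_preimage \<sigma> M B l) (q_exp \<sigma> M (p - l)) x))"

declare alpha_preimage.simps [simp del]

text \<open>\<open>alpha_preimage\<close> is \<open>alpha_triangular\<close> solved for its diagonal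
  term.\<close>

lemma alpha_surj:
  assumes braiding: "braiding \<sigma>" and B: "B \<in> End_sum \<sigma> M"
  shows "B \<in> alpha \<sigma> M ` End_sum \<sigma> M"
proof -
  \<comment> \<open>The recursion continues beyond M, where an element of the direct sum has to
    vanish.\<close>
  define A where "A p = (if p \<le> M then alpha_preimage \<sigma> M B p else (\<lambda>_. 0))" for p
  have "alpha_preimage \<sigma> M B p \<in> End (S_pow \<sigma> p)" if "p \<le> M" for p
    using that
  proof (induction p rule: less_induct)
    case (less p)
    have "B p \<in> End (S_pow \<sigma> p)" using B less.prems by (simp add: End_sum_def)
    then show ?case
      unfolding alpha_preimage.simps[of \<sigma> M B p]
      using less
      by (intro Hom_diff Hom_sum conv2_q_exp_End[OF braiding] subspace_S_pow[OF braiding]) auto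
  qed
  then have A: "A \<in> End_sum \<sigma> M" by (simp add: End_sum_def A_def)
  have "alpha \<sigma> M A p x = B p x" for p x
  proof (cases "p \<le> M")
    case True
    then show ?thesis
      unfolding alpha_triangular[OF braiding A True]
      by (simp add: A_def alpha_preimage.simps[of \<sigma> M B p])
  next
    case False
    then show ?thesis
      using alpha_End_sum[OF braiding A] B by (simp add: End_sum_def)
  qed
  then have "alpha \<sigma> M A = B" by blast
  with A show ?thesis by blast
qed

lemma fam_comp_End_sum:
  assumes "braiding \<sigma>" "A \<in> End_sum \<sigma> M" "B \<in> End_sum \<sigma> M"
  shows "fam_comp A B \<in> End_sum \<sigma> M"
  using assms by (auto simp: End_sum_def fam_comp_def intro: End_comp subspace_S_pow)

section \<open>The q-trace and the third product\<close>

lemma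
  assumes "braiding \<sigma>" "has_dim (S_pow \<sigma> M) 1" "A \<in> End_sum \<sigma> M"
  shows alpha_top_eq_q_trace: "alpha \<sigma> M A M = (\<lambda>x. q_trace \<sigma> M A *\<^sub>C Id_on_space (S_pow \<sigma> M) x)"
    and q_traceI: "alpha \<sigma> M A M = (\<lambda>x. c *\<^sub>C Id_on_space (S_pow \<sigma> M) x) \<Longrightarrow> q_trace \<sigma> M A = c"
proof -
  have "alpha \<sigma> M A M \<in> End (S_pow \<sigma> M)"
    using alpha_End_sum[OF assms(1,3)] by (simp add: End_sum_def)
  note ex1 = End_one_dim[OF assms(2) this]
  show "alpha \<sigma> M A M = (\<lambda>x. q_trace \<sigma> M A *\<^sub>C Id_on_space (S_pow \<sigma> M) x)"
    unfolding q_trace_def by (rule theI'[OF ex1])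
  show "q_trace \<sigma> M A = c" if "alpha \<sigma> M A M = (\<lambda>x. c *\<^sub>C Id_on_space (S_pow \<sigma> M) x)"
    unfolding q_trace_def using ex1 that by (rule the1_equality)
qed

lemma
  assumes "braiding \<sigma>" "A \<in> End_sum \<sigma> M" "B \<in> End_sum \<sigma> M"
  shows third_product_End_sum: "third_product \<sigma> M A B \<in> End_sum \<sigma> M"
    and alpha_third_product:
      "alpha \<sigma> M (third_product \<sigma> M A B) = fam_comp (alpha \<sigma> M A) (alpha \<sigma> M B)"
proof -
  have "fam_comp (alpha \<sigma> M A) (alpha \<sigma> M B) \<in> alpha \<sigma> M ` End_sum \<sigma> M"
    using assms by (intro alpha_surj fam_comp_End_sum alpha_End_sum)
  then show "third_product \<sigma> M A B \<in> End_sum \<sigma> M"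
    "alpha \<sigma> M (third_product \<sigma> M A B) = fam_comp (alpha \<sigma> M A) (alpha \<sigma> M B)"
    unfolding third_product_def alpha_inv_def by (rule inv_into_into, rule f_inv_into_f)
qed

lemma q_trace_third_product:
  assumes "braiding \<sigma>" "has_dim (S_pow \<sigma> M) 1" "A \<in> End_sum \<sigma> M" "B \<in> End_sum \<sigma> M"
  shows "q_trace \<sigma> M (third_product \<sigma> M A B) = q_trace \<sigma> M A * q_trace \<sigma> M B"
proof (rule q_traceI[OF assms(1,2) third_product_End_sum[OF assms(1,3,4)]])
  show "alpha \<sigma> M (third_product \<sigma> M A B) M =
      (\<lambda>x. (q_trace \<sigma> M A * q_trace \<sigma> M B) *\<^sub>C Id_on_space (S_pow \<sigma> M) x)"
    unfolding alpha_third_product[OF assms(1,3,4)] fam_comp_def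
      alpha_top_eq_q_trace[OF assms(1,2,3)] alpha_top_eq_q_trace[OF assms(1,2,4)]
    \<comment> \<open>The inner factor maps into \<open>S_pow \<sigma> M\<close>, where the outer
      identity acts; off this space both sides are 0.\<close>
    using subspace_S_pow[OF assms(1), of M]
    by (auto simp: fun_eq_iff restrict0_def scaleC_scaleC cvec.subspace_scale)
qed

lemma q_trace_fam_add:
  assumes "braiding \<sigma>" "has_dim (S_pow \<sigma> M) 1" "A \<in> End_sum \<sigma> M" "B \<in> End_sum \<sigma> M"
  shows "q_trace \<sigma> M (fam_add A B) = q_trace \<sigma> M A + q_trace \<sigma> M B"
proof (rule q_traceI[OF assms(1,2)])
  show "fam_add A B \<in> End_sum \<sigma> M"
    using assms(3,4) subspace_S_pow[OF assms(1)] by (auto simp: End_sum_def fam_add_def intro: Hom_add)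
  show "alpha \<sigma> M (fam_add A B) M =
      (\<lambda>x. (q_trace \<sigma> M A + q_trace \<sigma> M B) *\<^sub>C Id_on_space (S_pow \<sigma> M) x)"
    unfolding alpha_fam_add[OF assms(1,3,4)]
    by (simp add: fam_add_def alpha_top_eq_q_trace[OF assms(1,2)] assms(3,4) scaleC_add_left)
qed

theorem theorem2p9:
  fixes \<sigma> :: "('v::complex_vector, 'v) tensor \<Rightarrow> ('v, 'v) tensor"
    and \<nu> :: complex and M :: nat and A B :: "'v family"
  assumes "braiding \<sigma>"
    and "\<nu> \<noteq> 0" and "hecke_type \<nu> \<sigma>"
    and "\<forall>n>0. \<nu> ^ n \<noteq> 1"
    and "has_dim (S_pow \<sigma> M) 1"
    and "\<forall>p>M. has_dim (S_pow \<sigma> p) 0"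
    and "A \<in> End_sum \<sigma> M" and "B \<in> End_sum \<sigma> M"
  shows "q_trace \<sigma> M (fam_add A B) = q_trace \<sigma> M A + q_trace \<sigma> M B
    \<and> q_trace \<sigma> M (third_product \<sigma> M A B) = q_trace \<sigma> M A * q_trace \<sigma> M B
    \<and> q_trace \<sigma> M (third_product \<sigma> M A B) = q_trace \<sigma> M (third_product \<sigma> M B A)"
  \<comment> \<open>The third claim is the product formula in both orders; the scalars
    commute.\<close>
  using assms by (simp add: q_trace_fam_add q_trace_third_product)

end
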